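(* Let $\Phi:\mathcal B^{op}\to CAT$ be homotopically structured. (Left) Suppose that pushouts exist in $\int\Phi$ and in each fiber $\Phi(O)$. If $\int\Phi$ is left proper, then $\Phi(O)$ is left proper for every $O\in\mathcal B$. If, in addition, each $\Phi(O)$ has an initial object $i_O$, then $\mathcal B$ is left proper as well. (Right) Dually, suppose that pullbacks exist in $\int\Phi$ and in each fiber $\Phi(O)$, and that $\phi^*$ is a right adjoint for every morphism $\phi$ of $\mathcal B$. If $\int\Phi$ is right proper, then $\Phi(O)$ is right proper for every $O\in\mathcal B$. If, in addition, each $\Phi(O)$ has a terminal object $t_O$, then $\mathcal B$ is right proper as well.
   Context: Let $CAT$ be the category of (large) categories. For $\Phi:\mathcal B^{op}\to CAT$ and $\phi:O\to O'$ in $\mathcal B$ write $\phi^*=\Phi(\phi):\Phi(O')\to\Phi(O)$. The Grothendieck construction $\int\Phi$ has objects pairs $(O,A)$ with $O\in\mathcal B$, $A\in\Phi(O)$; a morphism $(O,A)\to(O',A')$ is a pair $(\phi,f)$ with $\phi:O\to O'$ and $f:A\to\phi^*(A')$ in $\Phi(O)$. $\Phi$ is homotopically structured if $\mathcal B$ is equipped with two classes of morphisms called horizontal weak equivalences and horizontal fibrations, and each $\Phi(O)$ with two classes called vertical weak equivalences and vertical fibrations. $(\phi,f)$ is a global weak equivalence (resp. fibration) if $\phi$ is a horizontal and $f$ a vertical weak equivalence (resp. fibration). In each setting (global on $\int\Phi$, horizontal on $\mathcal B$, vertical on $\Phi(O)$) trivial fibrations are fibrations that are weak equivalences and cofibrations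 are the morphisms with the left lifting property against trivial fibrations. Properness does not presuppose a model structure: a category with such classes is left proper if pushouts of weak equivalences along cofibrations are weak equivalences, and right proper if pullbacks of weak equivalences along fibrations are weak equivalences.
   Formalization: Added, since the literal claims fail: all identities are horizontal and vertical weak equivalences; in (Right) they are also horizontal and vertical fibrations; and, only for "Φ(O) is left proper", every φ* preserves vertical trivial fibrations. *)

theory Defs
  imports Main
begin

section \<open>Categories and functors\<close>

record ('o, 'm) cat =
  Ob :: "'o set"
  Arr :: "'m set"
  Dom :: "'m \<Rightarrow> 'o"
  Cod :: "'m \<Rightarrow> 'o"
  Ident :: "'o \<Rightarrow> 'm"
  Comp :: "'m \<Rightarrow> 'm \<Rightarrow> 'm" (infixl "\<cdot>\<index>" 70)

definition hom :: "('o, 'm) cat \<Rightarrow> 'o \<Rightarrow> 'o \<Rightarrow> 'm set" where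
  "hom C x y = {f \<in> Arr C. Dom C f = x \<and> Cod C f = y}"

locale category =
  fixes C :: "('o, 'm) cat" (structure)
  assumes dom_in [intro]: "f \<in> Arr C \<Longrightarrow> Dom C f \<in> Ob C"
    and cod_in [intro]: "f \<in> Arr C \<Longrightarrow> Cod C f \<in> Ob C"
    and ident_in [intro]: "x \<in> Ob C \<Longrightarrow> Ident C x \<in> hom C x x"
    and comp_in [intro]: "f \<in> hom C x y \<Longrightarrow> g \<in> hom C y z \<Longrightarrow> g \<cdot> f \<in> hom C x z"
    and comp_ident_right: "f \<in> hom C x y \<Longrightarrow> f \<cdot> Ident C x = f"
    and comp_ident_left: "f \<in> hom C x y \<Longrightarrow> Ident C y \<cdot> f = f"
    and comp_assoc: "f \<in> hom C x y \<Longrightarrow> g \<in> hom C y z \<Longrightarrow> h \<in> hom C z w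
        \<Longrightarrow> h \<cdot> (g \<cdot> f) = (h \<cdot> g) \<cdot> f"

record ('a, 'f, 'b, 'g) funct =
  on_ob :: "'a \<Rightarrow> 'b"
  on_arr :: "'f \<Rightarrow> 'g"

locale funct = source: category C + target: category D
  for C :: "('a, 'f) cat" and D :: "('b, 'g) cat" +
  fixes F :: "('a, 'f, 'b, 'g) funct"
  assumes ob_in: "x \<in> Ob C \<Longrightarrow> on_ob F x \<in> Ob D"
    and arr_in: "f \<in> hom C x y \<Longrightarrow> on_arr F f \<in> hom D (on_ob F x) (on_ob F y)"
    and on_ident: "x \<in> Ob C \<Longrightarrow> on_arr F (Ident C x) = Ident D (on_ob F x)"
    and on_comp: "f \<in> hom C x y \<Longrightarrow> g \<in> hom C y z
        \<Longrightarrow> on_arr F (g \<cdot>\<^bsub>C\<^esub> f) = on_arr F g \<cdot>\<^bsub>D\<^esub> on_arr F f"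

text \<open>\<open>F\<close> is left adjoint to \<open>G\<close>, by a natural family of bijections \<open>D(F x, y) \<cong> C(x, G y)\<close>.\<close>

definition adjoint ::
  "('a, 'f) cat \<Rightarrow> ('b, 'g) cat \<Rightarrow> ('a, 'f, 'b, 'g) funct \<Rightarrow> ('b, 'g, 'a, 'f) funct \<Rightarrow> bool" where
  "adjoint C D F G \<longleftrightarrow> funct C D F \<and> funct D C G \<and>
    (\<exists>\<theta> :: 'a \<Rightarrow> 'b \<Rightarrow> 'g \<Rightarrow> 'f.
      (\<forall>x\<in>Ob C. \<forall>y\<in>Ob D. bij_betw (\<theta> x y) (hom D (on_ob F x) y) (hom C x (on_ob G y))) \<and>
      (\<forall>x\<in>Ob C. \<forall>x'\<in>Ob C. \<forall>y\<in>Ob D. \<forall>y'\<in>Ob D.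
        \<forall>h\<in>hom C x' x. \<forall>k\<in>hom D y y'. \<forall>g\<in>hom D (on_ob F x) y.
          \<theta> x' y' (k \<cdot>\<^bsub>D\<^esub> g \<cdot>\<^bsub>D\<^esub> on_arr F h) = on_arr G k \<cdot>\<^bsub>C\<^esub> \<theta> x y g \<cdot>\<^bsub>C\<^esub> h))"

definition is_right_adjoint ::
  "('b, 'g) cat \<Rightarrow> ('a, 'f) cat \<Rightarrow> ('b, 'g, 'a, 'f) funct \<Rightarrow> bool" where
  "is_right_adjoint D C G \<longleftrightarrow> (\<exists>F. adjoint C D F G)"

definition is_initial :: "('o, 'm) cat \<Rightarrow> 'o \<Rightarrow> bool" where
  "is_initial C i \<longleftrightarrow> i \<in> Ob C \<and> (\<forall>x\<in>Ob C. \<exists>!f. f \<in> hom C i x)"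

definition is_terminal :: "('o, 'm) cat \<Rightarrow> 'o \<Rightarrow> bool" where
  "is_terminal C t \<longleftrightarrow> t \<in> Ob C \<and> (\<forall>x\<in>Ob C. \<exists>!f. f \<in> hom C x t)"

text \<open>
  \<open>is_pushout C f g f' g'\<close>: the square \<open>f' \<cdot> g = g' \<cdot> f\<close> is a pushout of the span \<open>f, g\<close>, where
  \<open>f'\<close> is opposite to \<open>f\<close>, that is, \<open>f'\<close> is the pushout of \<open>f\<close> along \<open>g\<close>. Likewise
  \<open>is_pullback C f g f' g'\<close> says that \<open>g \<cdot> f' = f \<cdot> g'\<close> is a pullback of the cospan \<open>f, g\<close>, and
  \<open>f'\<close> is the pullback of \<open>f\<close> along \<open>g\<close>.
\<close>

definition is_pushout :: "('o, 'm) cat \<Rightarrow> 'm \<Rightarrow> 'm \<Rightarrow> 'm \<Rightarrow> 'm \<Rightarrow> bool" where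
  "is_pushout C f g f' g' \<longleftrightarrow>
    f \<in> Arr C \<and> g \<in> Arr C \<and> f' \<in> Arr C \<and> g' \<in> Arr C \<and>
    Dom C f = Dom C g \<and> Dom C f' = Cod C g \<and> Dom C g' = Cod C f \<and> Cod C f' = Cod C g' \<and>
    f' \<cdot>\<^bsub>C\<^esub> g = g' \<cdot>\<^bsub>C\<^esub> f \<and>
    (\<forall>z\<in>Ob C. \<forall>u\<in>hom C (Cod C g) z. \<forall>v\<in>hom C (Cod C f) z. u \<cdot>\<^bsub>C\<^esub> g = v \<cdot>\<^bsub>C\<^esub> f \<longrightarrow>
      (\<exists>!h. h \<in> hom C (Cod C f') z \<and> h \<cdot>\<^bsub>C\<^esub> f' = u \<and> h \<cdot>\<^bsub>C\<^esub> g' = v))"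

definition is_pullback :: "('o, 'm) cat \<Rightarrow> 'm \<Rightarrow> 'm \<Rightarrow> 'm \<Rightarrow> 'm \<Rightarrow> bool" where
  "is_pullback C f g f' g' \<longleftrightarrow>
    f \<in> Arr C \<and> g \<in> Arr C \<and> f' \<in> Arr C \<and> g' \<in> Arr C \<and>
    Cod C f = Cod C g \<and> Cod C f' = Dom C g \<and> Cod C g' = Dom C f \<and> Dom C f' = Dom C g' \<and>
    g \<cdot>\<^bsub>C\<^esub> f' = f \<cdot>\<^bsub>C\<^esub> g' \<and>
    (\<forall>z\<in>Ob C. \<forall>u\<in>hom C z (Dom C g). \<forall>v\<in>hom C z (Dom C f). g \<cdot>\<^bsub>C\<^esub> u = f \<cdot>\<^bsub>C\<^esub> v \<longrightarrow>
      (\<exists>!h. h \<in> hom C z (Dom C f') \<and> f' \<cdot>\<^bsub>C\<^esub> h = u \<and> g' \<cdot>\<^bsub>C\<^esub> h = v))"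

definition has_pushouts :: "('o, 'm) cat \<Rightarrow> bool" where
  "has_pushouts C \<longleftrightarrow>
    (\<forall>f\<in>Arr C. \<forall>g\<in>Arr C. Dom C f = Dom C g \<longrightarrow> (\<exists>f' g'. is_pushout C f g f' g'))"

definition has_pullbacks :: "('o, 'm) cat \<Rightarrow> bool" where
  "has_pullbacks C \<longleftrightarrow>
    (\<forall>f\<in>Arr C. \<forall>g\<in>Arr C. Cod C f = Cod C g \<longrightarrow> (\<exists>f' g'. is_pullback C f g f' g'))"


section \<open>Weak equivalences, fibrations and properness\<close>

record 'm classes =
  weq :: "'m set"
  fib :: "'m set"

definition trivial_fibrations :: "'m classes \<Rightarrow> 'm set" where
  "trivial_fibrations S = fib S \<inter> weq S"

definition has_llp :: "('o, 'm) cat \<Rightarrow> 'm \<Rightarrow> 'm \<Rightarrow> bool" where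
  "has_llp C i p \<longleftrightarrow>
    (\<forall>u\<in>hom C (Dom C i) (Dom C p). \<forall>v\<in>hom C (Cod C i) (Cod C p). p \<cdot>\<^bsub>C\<^esub> u = v \<cdot>\<^bsub>C\<^esub> i \<longrightarrow>
      (\<exists>h\<in>hom C (Cod C i) (Dom C p). h \<cdot>\<^bsub>C\<^esub> i = u \<and> p \<cdot>\<^bsub>C\<^esub> h = v))"

definition cofibrations :: "('o, 'm) cat \<Rightarrow> 'm classes \<Rightarrow> 'm set" where
  "cofibrations C S = {i \<in> Arr C. \<forall>p\<in>trivial_fibrations S. has_llp C i p}"

definition left_proper :: "('o, 'm) cat \<Rightarrow> 'm classes \<Rightarrow> bool" where
  "left_proper C S \<longleftrightarrow>
    (\<forall>w c w' c'. is_pushout C w c w' c' \<and> w \<in> weq S \<and> c \<in> cofibrations C S \<longrightarrow> w' \<in> weq S)"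

definition right_proper :: "('o, 'm) cat \<Rightarrow> 'm classes \<Rightarrow> bool" where
  "right_proper C S \<longleftrightarrow>
    (\<forall>w p w' p'. is_pullback C w p w' p' \<and> w \<in> weq S \<and> p \<in> fib S \<longrightarrow> w' \<in> weq S)"

definition contains_identities :: "('o, 'm) cat \<Rightarrow> 'm set \<Rightarrow> bool" where
  "contains_identities C W \<longleftrightarrow> (\<forall>x\<in>Ob C. Ident C x \<in> W)"


section \<open>Functors to CAT and the Grothendieck construction\<close>

text \<open>
  A strict functor \<open>\<Phi> : B\<^sup>o\<^sup>p \<rightarrow> CAT\<close>. All fibers share the types of objects and arrows, but each has
  its own carriers, so this is no restriction (pass to disjoint unions). \<open>Restr \<Phi> \<phi>\<close> is the functor
  \<open>\<phi>\<^sup>*\<close>; functoriality is only required on the carriers of the fibers.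
\<close>

record ('o, 'm, 'a, 'f) cat_functor =
  Fiber :: "'o \<Rightarrow> ('a, 'f) cat"
  Restr :: "'m \<Rightarrow> ('a, 'f, 'a, 'f) funct"

locale cat_functor = base: category B
  for B :: "('o, 'm) cat" +
  fixes \<Phi> :: "('o, 'm, 'a, 'f) cat_functor"
  assumes fiber_category: "X \<in> Ob B \<Longrightarrow> category (Fiber \<Phi> X)"
    and restr_functor: "\<phi> \<in> hom B X Y \<Longrightarrow> funct (Fiber \<Phi> Y) (Fiber \<Phi> X) (Restr \<Phi> \<phi>)"
    and restr_ident_ob: "X \<in> Ob B \<Longrightarrow> A \<in> Ob (Fiber \<Phi> X) \<Longrightarrow> on_ob (Restr \<Phi> (Ident B X)) A = A"
    and restr_ident_arr: "X \<in> Ob B \<Longrightarrow> f \<in> Arr (Fiber \<Phi> X) \<Longrightarrow> on_arr (Restr \<Phi> (Ident B X)) f = f"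
    and restr_comp_ob: "\<phi> \<in> hom B X Y \<Longrightarrow> \<psi> \<in> hom B Y Z \<Longrightarrow> A \<in> Ob (Fiber \<Phi> Z)
        \<Longrightarrow> on_ob (Restr \<Phi> (\<psi> \<cdot>\<^bsub>B\<^esub> \<phi>)) A = on_ob (Restr \<Phi> \<phi>) (on_ob (Restr \<Phi> \<psi>) A)"
    and restr_comp_arr: "\<phi> \<in> hom B X Y \<Longrightarrow> \<psi> \<in> hom B Y Z \<Longrightarrow> f \<in> Arr (Fiber \<Phi> Z)
        \<Longrightarrow> on_arr (Restr \<Phi> (\<psi> \<cdot>\<^bsub>B\<^esub> \<phi>)) f = on_arr (Restr \<Phi> \<phi>) (on_arr (Restr \<Phi> \<psi>) f)"

text \<open>
  A morphism \<open>(\<phi>, f) : (X, A) \<rightarrow> (Y, A')\<close> is encoded as \<open>(\<phi>, f, A')\<close>, because \<open>A'\<close> is not determined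
  by \<open>f : A \<rightarrow> \<phi>\<^sup>* A'\<close>; the rest of the source and target is determined by \<open>\<phi>\<close> and \<open>f\<close>.
\<close>

definition grothendieck ::
  "('o, 'm) cat \<Rightarrow> ('o, 'm, 'a, 'f) cat_functor \<Rightarrow> ('o \<times> 'a, 'm \<times> 'f \<times> 'a) cat" where
  "grothendieck B \<Phi> = \<lparr>
    Ob = {(X, A). X \<in> Ob B \<and> A \<in> Ob (Fiber \<Phi> X)},
    Arr = {(\<phi>, f, A'). \<phi> \<in> Arr B \<and> f \<in> Arr (Fiber \<Phi> (Dom B \<phi>)) \<and> A' \<in> Ob (Fiber \<Phi> (Cod B \<phi>)) \<and>
            Cod (Fiber \<Phi> (Dom B \<phi>)) f = on_ob (Restr \<Phi> \<phi>) A'},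
    Dom = (\<lambda>(\<phi>, f, A'). (Dom B \<phi>, Dom (Fiber \<Phi> (Dom B \<phi>)) f)),
    Cod = (\<lambda>(\<phi>, f, A'). (Cod B \<phi>, A')),
    Ident = (\<lambda>(X, A). (Ident B X, Ident (Fiber \<Phi> X) A, A)),
    Comp = (\<lambda>(\<psi>, g, A'') (\<phi>, f, A').
      (\<psi> \<cdot>\<^bsub>B\<^esub> \<phi>, on_arr (Restr \<Phi> \<phi>) g \<cdot>\<^bsub>Fiber \<Phi> (Dom B \<phi>)\<^esub> f, A''))\<rparr>"

locale homotopically_structured = cat_functor B \<Phi>
  for B :: "('o, 'm) cat" and \<Phi> :: "('o, 'm, 'a, 'f) cat_functor" +
  fixes H :: "'m classes" and V :: "'o \<Rightarrow> 'f classes"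
  assumes horizontal_weq: "weq H \<subseteq> Arr B"
    and horizontal_fib: "fib H \<subseteq> Arr B"
    and vertical_weq: "X \<in> Ob B \<Longrightarrow> weq (V X) \<subseteq> Arr (Fiber \<Phi> X)"
    and vertical_fib: "X \<in> Ob B \<Longrightarrow> fib (V X) \<subseteq> Arr (Fiber \<Phi> X)"

definition global_classes ::
  "('o, 'm) cat \<Rightarrow> ('o, 'm, 'a, 'f) cat_functor \<Rightarrow> 'm classes \<Rightarrow> ('o \<Rightarrow> 'f classes)
    \<Rightarrow> ('m \<times> 'f \<times> 'a) classes" where
  "global_classes B \<Phi> H V = \<lparr>
    weq = {(\<phi>, f, A') \<in> Arr (grothendieck B \<Phi>). \<phi> \<in> weq H \<and> f \<in> weq (V (Dom B \<phi>))},
    fib = {(\<phi>, f, A') \<in> Arr (grothendieck B \<Phi>). \<phi> \<in> fib H \<and> f \<in> fib (V (Dom B \<phi>))}\<rparr>"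

text \<open>
  Every \<open>\<phi>\<^sup>*\<close> preserves vertical trivial fibrations. For a vertical cofibration \<open>c\<close>, this is what makes
  \<open>(id, c)\<close> a global cofibration; for arbitrary vertical classes \<open>(id, c)\<close> need not be one.
\<close>

definition restr_preserves_trivial_fibrations ::
  "('o, 'm) cat \<Rightarrow> ('o, 'm, 'a, 'f) cat_functor \<Rightarrow> ('o \<Rightarrow> 'f classes) \<Rightarrow> bool" where
  "restr_preserves_trivial_fibrations B \<Phi> V \<longleftrightarrow>
    (\<forall>X\<in>Ob B. \<forall>Y\<in>Ob B. \<forall>\<phi>\<in>hom B X Y.
      on_arr (Restr \<Phi> \<phi>) ` trivial_fibrations (V Y) \<subseteq> trivial_fibrations (V X))"

lemma (in cat_functor) grothendieck_hom_iff:
  "(\<phi>, f, A') \<in> hom (grothendieck B \<Phi>) (X, A) (Y, Z) \<longleftrightarrow>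
    \<phi> \<in> hom B X Y \<and> f \<in> hom (Fiber \<Phi> X) A (on_ob (Restr \<Phi> \<phi>) Z) \<and> A' = Z \<and> Z \<in> Ob (Fiber \<Phi> Y)"
  by (auto simp: hom_def grothendieck_def)

lemma (in cat_functor) category_grothendieck: "category (grothendieck B \<Phi>)"
proof -
  let ?G = "grothendieck B \<Phi>"
  have comp: "(\<psi>, g, A'') \<cdot>\<^bsub>?G\<^esub> (\<phi>, f, A')
      = (\<psi> \<cdot>\<^bsub>B\<^esub> \<phi>, on_arr (Restr \<Phi> \<phi>) g \<cdot>\<^bsub>Fiber \<Phi> (Dom B \<phi>)\<^esub> f, A'')" for \<psi> g A'' \<phi> f A'
    by (simp add: grothendieck_def)
  have dom_eq: "Dom B \<phi> = X" if "\<phi> \<in> hom B X Y" for \<phi> X Y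
    using that by (simp add: hom_def)
  have obs: "X \<in> Ob B" "Y \<in> Ob B" if "\<phi> \<in> hom B X Y" for \<phi> X Y
    using that base.dom_in base.cod_in by (auto simp: hom_def)
  have arr: "f \<in> Arr C" if "f \<in> hom C x y" for f x y and C :: "('a, 'f) cat"
    using that by (simp add: hom_def)
  show ?thesis
  proof
    fix t assume "t \<in> Arr ?G"
    then show "Dom ?G t \<in> Ob ?G" "Cod ?G t \<in> Ob ?G"
      using category.dom_in[OF fiber_category] by (auto simp: grothendieck_def)
  next
    fix x assume "x \<in> Ob ?G"
    then obtain X A where x: "x = (X, A)" "X \<in> Ob B" "A \<in> Ob (Fiber \<Phi> X)"
      by (auto simp: grothendieck_def)
    then have "Ident ?G x = (Ident B X, Ident (Fiber \<Phi> X) A, A)"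
      by (simp add: grothendieck_def)
    then show "Ident ?G x \<in> hom ?G x x"
      using x category.ident_in[OF fiber_category] base.ident_in
      by (simp add: grothendieck_hom_iff restr_ident_ob)
  next
    fix s t x y z assume s: "s \<in> hom ?G x y" and t: "t \<in> hom ?G y z"
    obtain X A Y C Z D where xyz: "x = (X, A)" "y = (Y, C)" "z = (Z, D)"
      by (metis surj_pair)
    obtain \<phi> f \<psi> g where st: "s = (\<phi>, f, C)" "t = (\<psi>, g, D)"
      using s t xyz by (metis grothendieck_hom_iff prod_cases3)
    have \<phi>: "\<phi> \<in> hom B X Y" and f: "f \<in> hom (Fiber \<Phi> X) A (on_ob (Restr \<Phi> \<phi>) C)"
      and \<psi>: "\<psi> \<in> hom B Y Z" and g: "g \<in> hom (Fiber \<Phi> Y) C (on_ob (Restr \<Phi> \<psi>) D)"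
      and D: "D \<in> Ob (Fiber \<Phi> Z)"
      using s t by (auto simp: xyz st grothendieck_hom_iff)
    have "on_arr (Restr \<Phi> \<phi>) g \<in>
        hom (Fiber \<Phi> X) (on_ob (Restr \<Phi> \<phi>) C) (on_ob (Restr \<Phi> (\<psi> \<cdot>\<^bsub>B\<^esub> \<phi>)) D)"
      using funct.arr_in[OF restr_functor[OF \<phi>] g] restr_comp_ob[OF \<phi> \<psi> D] by simp
    then show "t \<cdot>\<^bsub>?G\<^esub> s \<in> hom ?G x z"
      using category.comp_in[OF fiber_category[OF obs(1)[OF \<phi>]] f] base.comp_in[OF \<phi> \<psi>] D
      by (simp add: xyz st comp dom_eq[OF \<phi>] grothendieck_hom_iff)
  next
    fix s x y assume s: "s \<in> hom ?G x y"
    obtain X A Y C where xy: "x = (X, A)" "y = (Y, C)"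
      by (metis surj_pair)
    obtain \<phi> f where st: "s = (\<phi>, f, C)"
      using s xy by (metis grothendieck_hom_iff prod_cases3)
    have \<phi>: "\<phi> \<in> hom B X Y" and f: "f \<in> hom (Fiber \<Phi> X) A (on_ob (Restr \<Phi> \<phi>) C)"
      and C: "C \<in> Ob (Fiber \<Phi> Y)"
      using s by (auto simp: xy st grothendieck_hom_iff)
    note X = obs(1)[OF \<phi>]
    have A: "A \<in> Ob (Fiber \<Phi> X)"
      using f category.dom_in[OF fiber_category[OF X]] by (auto simp: hom_def)
    have ids: "Ident ?G x = (Ident B X, Ident (Fiber \<Phi> X) A, A)"
      "Ident ?G y = (Ident B Y, Ident (Fiber \<Phi> Y) C, C)"
      by (simp_all add: xy grothendieck_def)
    show "s \<cdot>\<^bsub>?G\<^esub> Ident ?G x = s"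
      unfolding ids st comp dom_eq[OF base.ident_in[OF X]] restr_ident_arr[OF X arr[OF f]]
      using base.comp_ident_right[OF \<phi>] category.comp_ident_right[OF fiber_category[OF X] f] by simp
    show "Ident ?G y \<cdot>\<^bsub>?G\<^esub> s = s"
      unfolding ids st comp dom_eq[OF \<phi>] funct.on_ident[OF restr_functor[OF \<phi>] C]
      using base.comp_ident_left[OF \<phi>] category.comp_ident_left[OF fiber_category[OF X] f] by simp
  next
    fix s t r x y z w
    assume s: "s \<in> hom ?G x y" and t: "t \<in> hom ?G y z" and r: "r \<in> hom ?G z w"
    obtain X A Y C Z D W E where xyz: "x = (X, A)" "y = (Y, C)" "z = (Z, D)" "w = (W, E)"
      by (metis surj_pair)
    obtain \<phi> f \<psi> g \<chi> h where str: "s = (\<phi>, f, C)" "t = (\<psi>, g, D)" "r = (\<chi>, h, E)"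
      using s t r xyz by (metis grothendieck_hom_iff prod_cases3)
    have \<phi>: "\<phi> \<in> hom B X Y" and f: "f \<in> hom (Fiber \<Phi> X) A (on_ob (Restr \<Phi> \<phi>) C)"
      and \<psi>: "\<psi> \<in> hom B Y Z" and g: "g \<in> hom (Fiber \<Phi> Y) C (on_ob (Restr \<Phi> \<psi>) D)"
      and \<chi>: "\<chi> \<in> hom B Z W" and h: "h \<in> hom (Fiber \<Phi> Z) D (on_ob (Restr \<Phi> \<chi>) E)"
      using s t r by (auto simp: xyz str grothendieck_hom_iff)
    note h\<psi> = funct.arr_in[OF restr_functor[OF \<psi>] h]
    show "r \<cdot>\<^bsub>?G\<^esub> (t \<cdot>\<^bsub>?G\<^esub> s) = (r \<cdot>\<^bsub>?G\<^esub> t) \<cdot>\<^bsub>?G\<^esub> s"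
      unfolding str comp dom_eq[OF \<phi>] dom_eq[OF \<psi>] dom_eq[OF base.comp_in[OF \<phi> \<psi>]]
        restr_comp_arr[OF \<phi> \<psi> arr[OF h]] funct.on_comp[OF restr_functor[OF \<phi>] g h\<psi>]
      using base.comp_assoc[OF \<phi> \<psi> \<chi>]
        category.comp_assoc[OF fiber_category[OF obs(1)[OF \<phi>]] f
          funct.arr_in[OF restr_functor[OF \<phi>] g] funct.arr_in[OF restr_functor[OF \<phi>] h\<psi>]]
      by simp
  qed
qed

end

theory Submission
  imports Defs
begin

text \<open>
  Each part embeds a square of a fiber, or of the base, into the total category \<open>\<integral>\<Phi>\<close> as a pushout or
  pullback along a global cofibration or fibration, applies global properness there, and reads
  the conclusion off one component of the resulting arrow. Identities being weak equivalences
  (and fibrations) lets an arrow with an identity in one component inherit the class of its other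
  component.

  Fibers: the square is embedded by \<open>f \<mapsto> (id, f)\<close>. Arrows of \<open>\<integral>\<Phi>\<close> out of an object over \<open>X\<close> are
  arrows of the fiber over \<open>X\<close> into pulled back objects, so fiberwise pushouts are pushouts in
  \<open>\<integral>\<Phi>\<close> (\<open>vert_pushout\<close>). For pullbacks, the arrows into the square live in other fibers, and the
  same holds because right adjoints \<open>\<phi>\<^sup>*\<close> preserve pullbacks (\<open>vert_pullback\<close>).

  Base, right properness: as \<open>\<phi>\<^sup>*\<close> preserves terminal objects, a pullback square of the base lifts to
  objects terminal in their fibers, with cartesian arrows \<open>(\<phi>, id)\<close> wherever the class of an arrow
  matters.

  Base, left properness: this is the delicate part, since \<open>\<phi>\<^sup>*\<close> need not preserve initial objects, so
  that the arrow \<open>(X, i) \<rightarrow> (X', i')\<close> over a weak equivalence \<open>w\<close> need not be one. It does factor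
  through the cartesian arrow \<open>(X, w\<^sup>* i') \<rightarrow> (X', i')\<close>, which is a weak equivalence. To use that
  arrow instead, a cofibration over \<open>c : X \<rightarrow> Y\<close> starting at \<open>(X, w\<^sup>* i')\<close> is needed. Pushouts in
  \<open>\<integral>\<Phi>\<close> provide one: push the cofibration \<open>(X, i) \<rightarrow> (Y, j)\<close> out along \<open>(X, i) \<rightarrow> (X, w\<^sup>* i')\<close>; the
  result can be taken to lie over \<open>c\<close> (\<open>pushforward_along_initial\<close>). The pasting law
  (\<open>pushout_cancel_left\<close>) then exhibits an arrow over \<open>w'\<close> as a pushout of a weak equivalence
  along a cofibration.
\<close>

section \<open>Pushouts and pullbacks in a category\<close>

lemma homE:
  assumes "f \<in> Arr C"
  shows "f \<in> hom C (Dom C f) (Cod C f)"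
  using assms by (simp add: hom_def)

lemma (in category) hom_ob:
  assumes "f \<in> hom C x y"
  shows "x \<in> Ob C" "y \<in> Ob C"
  using assms dom_in cod_in by (auto simp: hom_def)

lemma is_pushoutI:
  assumes "f \<in> hom C a b" "g \<in> hom C a c" "f' \<in> hom C c d" "g' \<in> hom C b d"
    and "f' \<cdot>\<^bsub>C\<^esub> g = g' \<cdot>\<^bsub>C\<^esub> f"
    and "\<And>z u v. \<lbrakk>z \<in> Ob C; u \<in> hom C c z; v \<in> hom C b z; u \<cdot>\<^bsub>C\<^esub> g = v \<cdot>\<^bsub>C\<^esub> f\<rbrakk>
      \<Longrightarrow> \<exists>!h. h \<in> hom C d z \<and> h \<cdot>\<^bsub>C\<^esub> f' = u \<and> h \<cdot>\<^bsub>C\<^esub> g' = v"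
  shows "is_pushout C f g f' g'"
proof -
  have "f \<in> Arr C" "g \<in> Arr C" "f' \<in> Arr C" "g' \<in> Arr C"
    and eqs: "Dom C f = a" "Dom C g = a" "Dom C f' = c" "Dom C g' = b"
    "Cod C f = b" "Cod C g = c" "Cod C f' = d" "Cod C g' = d"
    using assms(1-4) by (simp_all add: hom_def)
  then show ?thesis
    unfolding is_pushout_def eqs using assms(5) by (intro conjI ballI impI assms(6)) simp_all
qed

lemma is_pushoutD:
  assumes "is_pushout C f g f' g'"
  obtains a b c d where "f \<in> hom C a b" "g \<in> hom C a c" "f' \<in> hom C c d" "g' \<in> hom C b d"
    "f' \<cdot>\<^bsub>C\<^esub> g = g' \<cdot>\<^bsub>C\<^esub> f"
    "\<And>z u v. \<lbrakk>z \<in> Ob C; u \<in> hom C c z; v \<in> hom C b z; u \<cdot>\<^bsub>C\<^esub> g = v \<cdot>\<^bsub>C\<^esub> f\<rbrakk>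
      \<Longrightarrow> \<exists>!h. h \<in> hom C d z \<and> h \<cdot>\<^bsub>C\<^esub> f' = u \<and> h \<cdot>\<^bsub>C\<^esub> g' = v"
proof (rule that)
  let ?a = "Dom C f" and ?b = "Cod C f" and ?c = "Cod C g" and ?d = "Cod C f'"
  show "f \<in> hom C ?a ?b" "g \<in> hom C ?a ?c" "f' \<in> hom C ?c ?d" "g' \<in> hom C ?b ?d"
    "f' \<cdot>\<^bsub>C\<^esub> g = g' \<cdot>\<^bsub>C\<^esub> f"
    using assms by (simp_all add: is_pushout_def hom_def)
  show "\<exists>!h. h \<in> hom C ?d z \<and> h \<cdot>\<^bsub>C\<^esub> f' = u \<and> h \<cdot>\<^bsub>C\<^esub> g' = v"
    if "z \<in> Ob C" "u \<in> hom C ?c z" "v \<in> hom C ?b z" "u \<cdot>\<^bsub>C\<^esub> g = v \<cdot>\<^bsub>C\<^esub> f" for z u v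
    using assms that unfolding is_pushout_def by blast
qed

lemma is_pullbackI:
  assumes "f \<in> hom C b a" "g \<in> hom C c a" "f' \<in> hom C d c" "g' \<in> hom C d b"
    and "g \<cdot>\<^bsub>C\<^esub> f' = f \<cdot>\<^bsub>C\<^esub> g'"
    and "\<And>z u v. \<lbrakk>z \<in> Ob C; u \<in> hom C z c; v \<in> hom C z b; g \<cdot>\<^bsub>C\<^esub> u = f \<cdot>\<^bsub>C\<^esub> v\<rbrakk>
      \<Longrightarrow> \<exists>!h. h \<in> hom C z d \<and> f' \<cdot>\<^bsub>C\<^esub> h = u \<and> g' \<cdot>\<^bsub>C\<^esub> h = v"
  shows "is_pullback C f g f' g'"
proof -
  have "f \<in> Arr C" "g \<in> Arr C" "f' \<in> Arr C" "g' \<in> Arr C"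
    and eqs: "Dom C f = b" "Dom C g = c" "Dom C f' = d" "Dom C g' = d"
    "Cod C f = a" "Cod C g = a" "Cod C f' = c" "Cod C g' = b"
    using assms(1-4) by (simp_all add: hom_def)
  then show ?thesis
    unfolding is_pullback_def eqs using assms(5) by (intro conjI ballI impI assms(6)) simp_all
qed

lemma is_pullbackD:
  assumes "is_pullback C f g f' g'"
  obtains a b c d where "f \<in> hom C b a" "g \<in> hom C c a" "f' \<in> hom C d c" "g' \<in> hom C d b"
    "g \<cdot>\<^bsub>C\<^esub> f' = f \<cdot>\<^bsub>C\<^esub> g'"
    "\<And>z u v. \<lbrakk>z \<in> Ob C; u \<in> hom C z c; v \<in> hom C z b; g \<cdot>\<^bsub>C\<^esub> u = f \<cdot>\<^bsub>C\<^esub> v\<rbrakk>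
      \<Longrightarrow> \<exists>!h. h \<in> hom C z d \<and> f' \<cdot>\<^bsub>C\<^esub> h = u \<and> g' \<cdot>\<^bsub>C\<^esub> h = v"
proof (rule that)
  let ?a = "Cod C f" and ?b = "Dom C f" and ?c = "Dom C g" and ?d = "Dom C f'"
  show "f \<in> hom C ?b ?a" "g \<in> hom C ?c ?a" "f' \<in> hom C ?d ?c" "g' \<in> hom C ?d ?b"
    "g \<cdot>\<^bsub>C\<^esub> f' = f \<cdot>\<^bsub>C\<^esub> g'"
    using assms by (simp_all add: is_pullback_def hom_def)
  show "\<exists>!h. h \<in> hom C z ?d \<and> f' \<cdot>\<^bsub>C\<^esub> h = u \<and> g' \<cdot>\<^bsub>C\<^esub> h = v"
    if "z \<in> Ob C" "u \<in> hom C z ?c" "v \<in> hom C z ?b" "g \<cdot>\<^bsub>C\<^esub> u = f \<cdot>\<^bsub>C\<^esub> v" for z u v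
    using assms that unfolding is_pullback_def by blast
qed

lemma pushout_universal:
  assumes "is_pushout C f g f' g'" "f \<in> hom C a b" "g \<in> hom C a c" "f' \<in> hom C c d"
    and "z \<in> Ob C" "u \<in> hom C c z" "v \<in> hom C b z" "u \<cdot>\<^bsub>C\<^esub> g = v \<cdot>\<^bsub>C\<^esub> f"
  shows "\<exists>!h. h \<in> hom C d z \<and> h \<cdot>\<^bsub>C\<^esub> f' = u \<and> h \<cdot>\<^bsub>C\<^esub> g' = v"
proof -
  have eqs: "Cod C f = b" "Cod C g = c" "Cod C f' = d"
    using assms(2-4) by (simp_all add: hom_def)
  show ?thesis
    using assms(1) assms(5-8) unfolding is_pushout_def eqs by blast
qed

lemma pullback_universal:
  assumes "is_pullback C f g f' g'" "f \<in> hom C b a" "g \<in> hom C c a" "f' \<in> hom C d c"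
    and "z \<in> Ob C" "u \<in> hom C z c" "v \<in> hom C z b" "g \<cdot>\<^bsub>C\<^esub> u = f \<cdot>\<^bsub>C\<^esub> v"
  shows "\<exists>!h. h \<in> hom C z d \<and> f' \<cdot>\<^bsub>C\<^esub> h = u \<and> g' \<cdot>\<^bsub>C\<^esub> h = v"
proof -
  have eqs: "Dom C f = b" "Dom C g = c" "Dom C f' = d"
    using assms(2-4) by (simp_all add: hom_def)
  show ?thesis
    using assms(1) assms(5-8) unfolding is_pullback_def eqs by blast
qed

lemma has_llp_lift:
  assumes "has_llp C i p" "i \<in> hom C a b" "p \<in> hom C x y"
    and "u \<in> hom C a x" "v \<in> hom C b y" "p \<cdot>\<^bsub>C\<^esub> u = v \<cdot>\<^bsub>C\<^esub> i"
  obtains h where "h \<in> hom C b x" "h \<cdot>\<^bsub>C\<^esub> i = u" "p \<cdot>\<^bsub>C\<^esub> h = v"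
proof -
  have eqs: "Dom C i = a" "Cod C i = b" "Dom C p = x" "Cod C p = y"
    using assms(2,3) by (simp_all add: hom_def)
  show ?thesis
    using assms(1) assms(4-6) that unfolding has_llp_def eqs by blast
qed

lemma (in category) pushout_transport_iso:
  assumes po: "is_pushout C f g f' g'" and f': "f' \<in> hom C c d"
    and t: "t \<in> hom C d e" and s: "s \<in> hom C e d"
    and st: "s \<cdot> t = Ident C d" and ts: "t \<cdot> s = Ident C e"
  shows "is_pushout C f g (t \<cdot> f') (t \<cdot> g')"
proof -
  define a b where "a = Dom C f" and "b = Cod C f"
  have f: "f \<in> hom C a b" and g: "g \<in> hom C a c" and g': "g' \<in> hom C b d"
    and comm: "f' \<cdot> g = g' \<cdot> f"
    using po f' by (auto simp: is_pushout_def hom_def a_def b_def)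
  show ?thesis
  proof (rule is_pushoutI)
    show "f \<in> hom C a b" "g \<in> hom C a c" "t \<cdot> f' \<in> hom C c e" "t \<cdot> g' \<in> hom C b e"
      using f g comp_in[OF f' t] comp_in[OF g' t] by simp_all
    show "(t \<cdot> f') \<cdot> g = (t \<cdot> g') \<cdot> f"
      using comp_assoc[OF g f' t] comp_assoc[OF f g' t] comm by metis
    fix z u v
    assume z: "z \<in> Ob C" and u: "u \<in> hom C c z" and v: "v \<in> hom C b z" and uv: "u \<cdot> g = v \<cdot> f"
    obtain h where h: "h \<in> hom C d z" "h \<cdot> f' = u" "h \<cdot> g' = v"
      and uniq: "\<And>k. \<lbrakk>k \<in> hom C d z; k \<cdot> f' = u; k \<cdot> g' = v\<rbrakk> \<Longrightarrow> k = h"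
      using pushout_universal[OF po f g f' z u v uv] by blast
    show "\<exists>!h. h \<in> hom C e z \<and> h \<cdot> (t \<cdot> f') = u \<and> h \<cdot> (t \<cdot> g') = v"
    proof (rule ex1I)
      have hst: "h \<cdot> s \<cdot> t = h"
        using comp_assoc[OF t s h(1)] st comp_ident_right[OF h(1)] by simp
      have hs: "h \<cdot> s \<in> hom C e z"
        using comp_in[OF s h(1)] .
      show "h \<cdot> s \<in> hom C e z \<and> h \<cdot> s \<cdot> (t \<cdot> f') = u \<and> h \<cdot> s \<cdot> (t \<cdot> g') = v"
        using hs comp_assoc[OF f' t hs] comp_assoc[OF g' t hs] hst h by metis
      fix k assume k: "k \<in> hom C e z \<and> k \<cdot> (t \<cdot> f') = u \<and> k \<cdot> (t \<cdot> g') = v"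
      then have kh: "k \<in> hom C e z" ..
      have "k \<cdot> t = h"
        using k comp_assoc[OF f' t kh] comp_assoc[OF g' t kh] comp_in[OF t kh] by (intro uniq) auto
      then show "k = h \<cdot> s"
        using comp_assoc[OF s t kh] ts comp_ident_right[OF kh] by simp
    qed
  qed
qed

text \<open>
  Pasting law: in a horizontal composite of two squares, with left square \<open>f, e, f', e'\<close> and
  right square \<open>w, f', w', c'\<close>, the right one is a pushout as soon as the left one and the
  outer rectangle are.
\<close>

lemma (in category) pushout_cancel_left:
  assumes left: "is_pushout C f e f' e'"
    and outer: "is_pushout C (w \<cdot> e) f (w' \<cdot> e') c'"
    and f: "f \<in> hom C a b" and e: "e \<in> hom C a a1" and f': "f' \<in> hom C a1 b1" and e': "e' \<in> hom C b b1"
    and w: "w \<in> hom C a1 a2" and w': "w' \<in> hom C b1 d" and c': "c' \<in> hom C a2 d"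
    and comm: "w' \<cdot> f' = c' \<cdot> w"
  shows "is_pushout C w f' w' c'"
proof (rule is_pushoutI[OF w f' w' c' comm])
  have we: "w \<cdot> e \<in> hom C a a2" and we': "w' \<cdot> e' \<in> hom C b d"
    using comp_in e w e' w' by blast+
  have left_comm: "f' \<cdot> e = e' \<cdot> f"
    using left by (simp add: is_pushout_def)
  have left_univ: "\<exists>!h. h \<in> hom C b1 z \<and> h \<cdot> f' = u \<and> h \<cdot> e' = v"
    if "z \<in> Ob C" "u \<in> hom C a1 z" "v \<in> hom C b z" "u \<cdot> e = v \<cdot> f" for z u v
    using pushout_universal[OF left f e f' that] .
  have outer_univ: "\<exists>!h. h \<in> hom C d z \<and> h \<cdot> (w' \<cdot> e') = u \<and> h \<cdot> c' = v"
    if "z \<in> Ob C" "u \<in> hom C b z" "v \<in> hom C a2 z" "u \<cdot> f = v \<cdot> (w \<cdot> e)" for z u v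
    using pushout_universal[OF outer we f we' that] .
  fix z u v
  assume z: "z \<in> Ob C" and u: "u \<in> hom C b1 z" and v: "v \<in> hom C a2 z" and uv: "u \<cdot> f' = v \<cdot> w"
  have ue: "u \<cdot> e' \<in> hom C b z"
    using comp_in[OF e' u] .
  have "u \<cdot> e' \<cdot> f = v \<cdot> (w \<cdot> e)"
    using comp_assoc[OF f e' u] comp_assoc[OF e f' u] comp_assoc[OF e w v] left_comm uv by metis
  then obtain h where h: "h \<in> hom C d z" "h \<cdot> (w' \<cdot> e') = u \<cdot> e'" "h \<cdot> c' = v"
    and uniq: "\<And>k. \<lbrakk>k \<in> hom C d z; k \<cdot> (w' \<cdot> e') = u \<cdot> e'; k \<cdot> c' = v\<rbrakk> \<Longrightarrow> k = h"
    using outer_univ[OF z ue v] by blast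
  have hw: "h \<cdot> w' \<in> hom C b1 z"
    using comp_in[OF w' h(1)] .
  have hw1: "h \<cdot> w' \<cdot> f' = u \<cdot> f'"
    using comp_assoc[OF f' w' h(1)] comp_assoc[OF w c' h(1)] comm h(3) uv by metis
  have hw2: "h \<cdot> w' \<cdot> e' = u \<cdot> e'"
    using comp_assoc[OF e' w' h(1)] h(2) by metis
  have "u \<cdot> f' \<cdot> e = u \<cdot> e' \<cdot> f"
    using comp_assoc[OF f e' u] comp_assoc[OF e f' u] left_comm by metis
  then have "h \<cdot> w' = u"
    using left_univ[OF z comp_in[OF f' u] ue] hw hw1 hw2 u by blast
  moreover have "k = h" if k: "k \<in> hom C d z" "k \<cdot> w' = u" "k \<cdot> c' = v" for k
    using uniq[OF k(1) _ k(3)] comp_assoc[OF e' w' k(1)] k(2) by simp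
  ultimately show "\<exists>!h. h \<in> hom C d z \<and> h \<cdot> w' = u \<and> h \<cdot> c' = v"
    using h by blast
qed

lemma (in category) cofibration_pushout:
  assumes po: "is_pushout C f g f' g'" and f_cof: "f \<in> cofibrations C S"
    and arr: "trivial_fibrations S \<subseteq> Arr C"
  shows "f' \<in> cofibrations C S"
  using po
proof (rule is_pushoutD)
  fix a b c d
  assume f: "f \<in> hom C a b" and g: "g \<in> hom C a c" and f': "f' \<in> hom C c d"
    and g': "g' \<in> hom C b d" and comm: "f' \<cdot> g = g' \<cdot> f"
    and univ: "\<And>z u v. \<lbrakk>z \<in> Ob C; u \<in> hom C c z; v \<in> hom C b z; u \<cdot> g = v \<cdot> f\<rbrakk>
      \<Longrightarrow> \<exists>!h. h \<in> hom C d z \<and> h \<cdot> f' = u \<and> h \<cdot> g' = v"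
  have "has_llp C f' p" if p_triv: "p \<in> trivial_fibrations S" for p
    unfolding has_llp_def
  proof (intro ballI impI)
    fix u v
    assume "u \<in> hom C (Dom C f') (Dom C p)" "v \<in> hom C (Cod C f') (Cod C p)"
      and sq: "p \<cdot> u = v \<cdot> f'"
    then have u: "u \<in> hom C c (Dom C p)" and v: "v \<in> hom C d (Cod C p)"
      using f' by (auto simp: hom_def)
    have p: "p \<in> hom C (Dom C p) (Cod C p)"
      using p_triv arr by (auto simp: hom_def)
    have ug: "u \<cdot> g \<in> hom C a (Dom C p)" and vg: "v \<cdot> g' \<in> hom C b (Cod C p)"
      using comp_in g u g' v by blast+
    have "p \<cdot> (u \<cdot> g) = v \<cdot> g' \<cdot> f"
      using comp_assoc[OF g u p] comp_assoc[OF g f' v] comp_assoc[OF f g' v] sq comm by metis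
    moreover have "has_llp C f p"
      using f_cof p_triv by (simp add: cofibrations_def)
    ultimately obtain h where h: "h \<in> hom C b (Dom C p)" "h \<cdot> f = u \<cdot> g" "p \<cdot> h = v \<cdot> g'"
      using has_llp_lift[OF _ f p ug vg] by blast
    obtain k where k: "k \<in> hom C d (Dom C p)" "k \<cdot> f' = u" "k \<cdot> g' = h"
      using univ[OF hom_ob(1)[OF p] u h(1) h(2)[symmetric]] by blast
    \<comment> \<open>The lower triangle commutes because both sides restrict to the same pair on the pushout.\<close>
    have "p \<cdot> u \<cdot> g = p \<cdot> h \<cdot> f"
      using comp_assoc[OF g u p] comp_assoc[OF f h(1) p] h(2) by metis
    then have ex1: "\<exists>!k. k \<in> hom C d (Cod C p) \<and> k \<cdot> f' = p \<cdot> u \<and> k \<cdot> g' = p \<cdot> h"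
      by (rule univ[OF hom_ob(2)[OF p] comp_in[OF u p] comp_in[OF h(1) p]])
    have "p \<cdot> k \<cdot> f' = p \<cdot> u" "p \<cdot> k \<cdot> g' = p \<cdot> h"
      using comp_assoc[OF f' k(1) p] comp_assoc[OF g' k(1) p] k by simp_all
    then have "p \<cdot> k = v"
      using ex1 comp_in[OF k(1) p] v sq[symmetric] h(3)[symmetric] by blast
    then show "\<exists>h\<in>hom C (Cod C f') (Dom C p). h \<cdot> f' = u \<and> p \<cdot> h = v"
      using k f' by (auto simp: hom_def)
  qed
  then show ?thesis
    using f' by (simp add: cofibrations_def hom_def)
qed


section \<open>Right adjoints preserve pullbacks and terminal objects\<close>

lemma adjointE:
  assumes "adjoint C D F G"
  obtains \<theta> where
    "\<And>x y. \<lbrakk>x \<in> Ob C; y \<in> Ob D\<rbrakk> \<Longrightarrow> bij_betw (\<theta> x y) (hom D (on_ob F x) y) (hom C x (on_ob G y))"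
    "\<And>x y y' k g. \<lbrakk>x \<in> Ob C; k \<in> hom D y y'; g \<in> hom D (on_ob F x) y\<rbrakk>
      \<Longrightarrow> \<theta> x y' (k \<cdot>\<^bsub>D\<^esub> g) = on_arr G k \<cdot>\<^bsub>C\<^esub> \<theta> x y g"
proof -
  have F: "funct C D F" and G: "funct D C G"
    using assms by (simp_all add: adjoint_def)
  interpret F: funct C D F by (rule F)
  interpret G: funct D C G by (rule G)
  obtain \<theta> where
    bij: "\<forall>x\<in>Ob C. \<forall>y\<in>Ob D. bij_betw (\<theta> x y) (hom D (on_ob F x) y) (hom C x (on_ob G y))"
    and nat: "\<forall>x\<in>Ob C. \<forall>x'\<in>Ob C. \<forall>y\<in>Ob D. \<forall>y'\<in>Ob D.
        \<forall>h\<in>hom C x' x. \<forall>k\<in>hom D y y'. \<forall>g\<in>hom D (on_ob F x) y.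
          \<theta> x' y' (k \<cdot>\<^bsub>D\<^esub> g \<cdot>\<^bsub>D\<^esub> on_arr F h) = on_arr G k \<cdot>\<^bsub>C\<^esub> \<theta> x y g \<cdot>\<^bsub>C\<^esub> h"
    using assms unfolding adjoint_def by blast
  show ?thesis
  proof (rule that)
    show "bij_betw (\<theta> x y) (hom D (on_ob F x) y) (hom C x (on_ob G y))"
      if "x \<in> Ob C" "y \<in> Ob D" for x y
      using bij that by blast
    fix x y y' k g
    assume x: "x \<in> Ob C" and k: "k \<in> hom D y y'" and g: "g \<in> hom D (on_ob F x) y"
    note y = F.target.hom_ob[OF k]
    have \<theta>g: "\<theta> x y g \<in> hom C x (on_ob G y)"
      using bij x y(1) g by (meson bij_betwE)
    have "\<theta> x y' (k \<cdot>\<^bsub>D\<^esub> g \<cdot>\<^bsub>D\<^esub> on_arr F (Ident C x)) = on_arr G k \<cdot>\<^bsub>C\<^esub> \<theta> x y g \<cdot>\<^bsub>C\<^esub> Ident C x"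
      using nat x y F.source.ident_in[OF x] k g by blast
    then show "\<theta> x y' (k \<cdot>\<^bsub>D\<^esub> g) = on_arr G k \<cdot>\<^bsub>C\<^esub> \<theta> x y g"
      using F.on_ident[OF x] F.target.comp_ident_right[OF F.target.comp_in[OF g k]]
        F.source.comp_ident_right[OF F.source.comp_in[OF \<theta>g G.arr_in[OF k]]] by simp
  qed
qed

lemma right_adjoint_preserves_terminal:
  assumes ra: "is_right_adjoint D C G" and t: "is_terminal D t"
  shows "is_terminal C (on_ob G t)"
proof -
  obtain F where adj: "adjoint C D F G"
    using ra by (auto simp: is_right_adjoint_def)
  obtain \<theta> where bij: "\<And>x y. \<lbrakk>x \<in> Ob C; y \<in> Ob D\<rbrakk>
      \<Longrightarrow> bij_betw (\<theta> x y) (hom D (on_ob F x) y) (hom C x (on_ob G y))"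
    using adj by (rule adjointE) blast
  have F: "funct C D F" and G: "funct D C G"
    using adj by (simp_all add: adjoint_def)
  have tD: "t \<in> Ob D"
    using t by (simp add: is_terminal_def)
  have "\<exists>!f. f \<in> hom C x (on_ob G t)" if x: "x \<in> Ob C" for x
  proof -
    obtain f where "hom D (on_ob F x) t = {f}"
      using t funct.ob_in[OF F x] unfolding is_terminal_def by blast
    then have "hom C x (on_ob G t) = {\<theta> x t f}"
      using bij_betw_imp_surj_on[OF bij[OF x tD]] by simp
    then show ?thesis
      by simp
  qed
  then show ?thesis
    using funct.ob_in[OF G tD] by (simp add: is_terminal_def)
qed

lemma right_adjoint_preserves_pullback:
  assumes ra: "is_right_adjoint D C G" and pb: "is_pullback D f g f' g'"
  shows "is_pullback C (on_arr G f) (on_arr G g) (on_arr G f') (on_arr G g')"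
  using pb
proof (rule is_pullbackD)
  fix a b c d
  assume f: "f \<in> hom D b a" and g: "g \<in> hom D c a" and f': "f' \<in> hom D d c"
    and g': "g' \<in> hom D d b" and comm: "g \<cdot>\<^bsub>D\<^esub> f' = f \<cdot>\<^bsub>D\<^esub> g'"
    and univ: "\<And>z u v. \<lbrakk>z \<in> Ob D; u \<in> hom D z c; v \<in> hom D z b; g \<cdot>\<^bsub>D\<^esub> u = f \<cdot>\<^bsub>D\<^esub> v\<rbrakk>
      \<Longrightarrow> \<exists>!h. h \<in> hom D z d \<and> f' \<cdot>\<^bsub>D\<^esub> h = u \<and> g' \<cdot>\<^bsub>D\<^esub> h = v"
  obtain F where adj: "adjoint C D F G"
    using ra by (auto simp: is_right_adjoint_def)
  obtain \<theta> where bij: "\<And>x y. \<lbrakk>x \<in> Ob C; y \<in> Ob D\<rbrakk>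
      \<Longrightarrow> bij_betw (\<theta> x y) (hom D (on_ob F x) y) (hom C x (on_ob G y))"
    and nat: "\<And>x y y' k g. \<lbrakk>x \<in> Ob C; k \<in> hom D y y'; g \<in> hom D (on_ob F x) y\<rbrakk>
      \<Longrightarrow> \<theta> x y' (k \<cdot>\<^bsub>D\<^esub> g) = on_arr G k \<cdot>\<^bsub>C\<^esub> \<theta> x y g"
    using adj by (rule adjointE) blast
  interpret F: funct C D F using adj by (simp add: adjoint_def)
  interpret G: funct D C G using adj by (simp add: adjoint_def)
  note obs = F.target.hom_ob[OF f] F.target.hom_ob[OF g] F.target.hom_ob[OF f']
  show ?thesis
  proof (rule is_pullbackI)
    show "on_arr G f \<in> hom C (on_ob G b) (on_ob G a)" "on_arr G g \<in> hom C (on_ob G c) (on_ob G a)"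
      "on_arr G f' \<in> hom C (on_ob G d) (on_ob G c)" "on_arr G g' \<in> hom C (on_ob G d) (on_ob G b)"
      using G.arr_in f g f' g' by blast+
    show "on_arr G g \<cdot>\<^bsub>C\<^esub> on_arr G f' = on_arr G f \<cdot>\<^bsub>C\<^esub> on_arr G g'"
      using G.on_comp[OF f' g] G.on_comp[OF g' f] comm by simp
    fix x u v
    assume x: "x \<in> Ob C" and u: "u \<in> hom C x (on_ob G c)" and v: "v \<in> hom C x (on_ob G b)"
      and sq: "on_arr G g \<cdot>\<^bsub>C\<^esub> u = on_arr G f \<cdot>\<^bsub>C\<^esub> v"
    obtain u0 where u0: "u0 \<in> hom D (on_ob F x) c" "u = \<theta> x c u0"
      using bij_betw_imp_surj_on[OF bij[OF x obs(3)]] u by blast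
    obtain v0 where v0: "v0 \<in> hom D (on_ob F x) b" "v = \<theta> x b v0"
      using bij_betw_imp_surj_on[OF bij[OF x obs(1)]] v by blast
    have inj: "k = l" if "y \<in> Ob D" "\<theta> x y k = \<theta> x y l" "k \<in> hom D (on_ob F x) y" "l \<in> hom D (on_ob F x) y" for y k l
      using bij_betw_imp_inj_on[OF bij[OF x that(1)]] that by (meson inj_onD)
    have "g \<cdot>\<^bsub>D\<^esub> u0 = f \<cdot>\<^bsub>D\<^esub> v0"
      using nat[OF x g u0(1)] nat[OF x f v0(1)] sq u0 v0
        F.target.comp_in[OF u0(1) g] F.target.comp_in[OF v0(1) f] by (intro inj[OF obs(2)]) simp_all
    then obtain h where h: "h \<in> hom D (on_ob F x) d" "f' \<cdot>\<^bsub>D\<^esub> h = u0" "g' \<cdot>\<^bsub>D\<^esub> h = v0"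
      and uniq: "\<And>k. \<lbrakk>k \<in> hom D (on_ob F x) d; f' \<cdot>\<^bsub>D\<^esub> k = u0; g' \<cdot>\<^bsub>D\<^esub> k = v0\<rbrakk> \<Longrightarrow> k = h"
      using univ[OF F.ob_in[OF x] u0(1) v0(1)] by blast
    show "\<exists>!h. h \<in> hom C x (on_ob G d) \<and> on_arr G f' \<cdot>\<^bsub>C\<^esub> h = u \<and> on_arr G g' \<cdot>\<^bsub>C\<^esub> h = v"
    proof (rule ex1I)
      show "\<theta> x d h \<in> hom C x (on_ob G d) \<and> on_arr G f' \<cdot>\<^bsub>C\<^esub> \<theta> x d h = u
          \<and> on_arr G g' \<cdot>\<^bsub>C\<^esub> \<theta> x d h = v"
        using bij_betwE[OF bij[OF x obs(5)]] nat[OF x f' h(1)] nat[OF x g' h(1)] h u0 v0 by simp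
      fix k assume k: "k \<in> hom C x (on_ob G d) \<and> on_arr G f' \<cdot>\<^bsub>C\<^esub> k = u \<and> on_arr G g' \<cdot>\<^bsub>C\<^esub> k = v"
      obtain k0 where k0: "k0 \<in> hom D (on_ob F x) d" "k = \<theta> x d k0"
        using bij_betw_imp_surj_on[OF bij[OF x obs(5)]] k by blast
      have "f' \<cdot>\<^bsub>D\<^esub> k0 = u0"
        using nat[OF x f' k0(1)] k k0 u0 F.target.comp_in[OF k0(1) f']
        by (intro inj[OF obs(3)]) simp_all
      moreover have "g' \<cdot>\<^bsub>D\<^esub> k0 = v0"
        using nat[OF x g' k0(1)] k k0 v0 F.target.comp_in[OF k0(1) g']
        by (intro inj[OF obs(1)]) simp_all
      ultimately show "k = \<theta> x d h"
        using uniq k0 by simp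
    qed
  qed
qed


section \<open>Vertical arrows of the Grothendieck construction\<close>

context cat_functor
begin

abbreviation Total :: "('o \<times> 'a, 'm \<times> 'f \<times> 'a) cat" where
  "Total \<equiv> grothendieck B \<Phi>"

abbreviation pull_ob :: "'m \<Rightarrow> 'a \<Rightarrow> 'a" where
  "pull_ob \<phi> \<equiv> on_ob (Restr \<Phi> \<phi>)"

abbreviation pull_arr :: "'m \<Rightarrow> 'f \<Rightarrow> 'f" where
  "pull_arr \<phi> \<equiv> on_arr (Restr \<Phi> \<phi>)"

definition vert :: "'o \<Rightarrow> 'f \<Rightarrow> 'm \<times> 'f \<times> 'a" where
  "vert X f = (Ident B X, f, Cod (Fiber \<Phi> X) f)"

sublocale total: category Total
  by (rule category_grothendieck)

lemma total_ob_iff: "(X, A) \<in> Ob Total \<longleftrightarrow> X \<in> Ob B \<and> A \<in> Ob (Fiber \<Phi> X)"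
  by (simp add: grothendieck_def)

lemma total_homE:
  assumes "t \<in> hom Total (X, A) (Y, E)"
  obtains \<phi> f where "t = (\<phi>, f, E)" "\<phi> \<in> hom B X Y" "f \<in> hom (Fiber \<Phi> X) A (pull_ob \<phi> E)"
    "E \<in> Ob (Fiber \<Phi> Y)"
  using assms by (metis grothendieck_hom_iff prod_cases3)

lemma total_comp:
  assumes "\<phi> \<in> hom B X Y"
  shows "(\<psi>, g, E) \<cdot>\<^bsub>Total\<^esub> (\<phi>, f, A) = (\<psi> \<cdot>\<^bsub>B\<^esub> \<phi>, pull_arr \<phi> g \<cdot>\<^bsub>Fiber \<Phi> X\<^esub> f, E)"
  using assms by (simp add: grothendieck_def hom_def)

lemma fst_total_comp: "fst (t \<cdot>\<^bsub>Total\<^esub> s) = fst t \<cdot>\<^bsub>B\<^esub> fst s"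
  by (cases t, cases s) (simp add: grothendieck_def)

lemma fst_total_hom: "t \<in> hom Total (X, A) (Y, E) \<Longrightarrow> fst t \<in> hom B X Y"
  by (erule total_homE) simp

lemma vert_in_hom:
  assumes X: "X \<in> Ob B" and f: "f \<in> hom (Fiber \<Phi> X) A A'"
  shows "vert X f \<in> hom Total (X, A) (X, A')"
proof -
  have "A' \<in> Ob (Fiber \<Phi> X)" "Cod (Fiber \<Phi> X) f = A'"
    using category.hom_ob[OF fiber_category[OF X] f] f by (auto simp: hom_def)
  then show ?thesis
    using base.ident_in[OF X] f restr_ident_ob[OF X] by (simp add: vert_def grothendieck_hom_iff)
qed

lemma comp_vert_right:
  assumes f: "f \<in> hom (Fiber \<Phi> X) A A'" and \<phi>: "\<phi> \<in> hom B X Z"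
    and g: "g \<in> hom (Fiber \<Phi> X) A' (pull_ob \<phi> E)"
  shows "(\<phi>, g, E) \<cdot>\<^bsub>Total\<^esub> vert X f = (\<phi>, g \<cdot>\<^bsub>Fiber \<Phi> X\<^esub> f, E)"
proof -
  note X = base.hom_ob(1)[OF \<phi>]
  have "g \<in> Arr (Fiber \<Phi> X)"
    using g by (simp add: hom_def)
  then show ?thesis
    unfolding vert_def total_comp[OF base.ident_in[OF X]]
    using base.comp_ident_right[OF \<phi>] restr_ident_arr[OF X] by simp
qed

lemma comp_vert_left:
  assumes \<phi>: "\<phi> \<in> hom B Z X" and g: "g \<in> hom (Fiber \<Phi> X) A' A''"
  shows "vert X g \<cdot>\<^bsub>Total\<^esub> (\<phi>, f, A') = (\<phi>, pull_arr \<phi> g \<cdot>\<^bsub>Fiber \<Phi> Z\<^esub> f, A'')"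
  using base.comp_ident_left[OF \<phi>] g by (simp add: vert_def total_comp[OF \<phi>] hom_def)

lemma vert_comp:
  assumes X: "X \<in> Ob B" and f: "f \<in> hom (Fiber \<Phi> X) A A'" and g: "g \<in> hom (Fiber \<Phi> X) A' A''"
  shows "vert X g \<cdot>\<^bsub>Total\<^esub> vert X f = vert X (g \<cdot>\<^bsub>Fiber \<Phi> X\<^esub> f)"
proof -
  interpret fX: category "Fiber \<Phi> X" using fiber_category[OF X] .
  have "Cod (Fiber \<Phi> X) g = A''" "Cod (Fiber \<Phi> X) (g \<cdot>\<^bsub>Fiber \<Phi> X\<^esub> f) = A''"
    using g fX.comp_in[OF f g] by (auto simp: hom_def)
  moreover have "g \<in> hom (Fiber \<Phi> X) A' (pull_ob (Ident B X) A'')"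
    using g restr_ident_ob[OF X] fX.hom_ob(2)[OF g] by simp
  ultimately show ?thesis
    using comp_vert_right[OF f base.ident_in[OF X]] by (simp add: vert_def)
qed

text \<open>
  An arrow \<open>(X, C) \<rightarrow> (Z, E)\<close> over \<open>\<phi>\<close> is an arrow \<open>C \<rightarrow> \<phi>\<^sup>* E\<close> of the fiber over \<open>X\<close>. So a
  cocone in the total category under a vertical span is a cocone in the fiber together with a
  single base arrow, and a fiberwise pushout remains a pushout.
\<close>

lemma vert_pushout:
  assumes X: "X \<in> Ob B" and po: "is_pushout (Fiber \<Phi> X) f g f' g'"
  shows "is_pushout Total (vert X f) (vert X g) (vert X f') (vert X g')"
  using po
proof (rule is_pushoutD)
  let ?F = "Fiber \<Phi> X"
  interpret fX: category ?F using fiber_category[OF X] .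
  fix a b c d
  assume f: "f \<in> hom ?F a b" and g: "g \<in> hom ?F a c" and f': "f' \<in> hom ?F c d"
    and g': "g' \<in> hom ?F b d" and comm: "f' \<cdot>\<^bsub>?F\<^esub> g = g' \<cdot>\<^bsub>?F\<^esub> f"
    and univ: "\<And>z u v. \<lbrakk>z \<in> Ob ?F; u \<in> hom ?F c z; v \<in> hom ?F b z; u \<cdot>\<^bsub>?F\<^esub> g = v \<cdot>\<^bsub>?F\<^esub> f\<rbrakk>
      \<Longrightarrow> \<exists>!h. h \<in> hom ?F d z \<and> h \<cdot>\<^bsub>?F\<^esub> f' = u \<and> h \<cdot>\<^bsub>?F\<^esub> g' = v"
  show ?thesis
  proof (rule is_pushoutI)
    show "vert X f \<in> hom Total (X, a) (X, b)" "vert X g \<in> hom Total (X, a) (X, c)"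
      "vert X f' \<in> hom Total (X, c) (X, d)" "vert X g' \<in> hom Total (X, b) (X, d)"
      using vert_in_hom[OF X] f g f' g' by blast+
    show "vert X f' \<cdot>\<^bsub>Total\<^esub> vert X g = vert X g' \<cdot>\<^bsub>Total\<^esub> vert X f"
      using vert_comp[OF X g f'] vert_comp[OF X f g'] comm by simp
    fix z s t
    assume s: "s \<in> hom Total (X, c) z" and t: "t \<in> hom Total (X, b) z"
      and st: "s \<cdot>\<^bsub>Total\<^esub> vert X g = t \<cdot>\<^bsub>Total\<^esub> vert X f"
    obtain Z E where z: "z = (Z, E)"
      by (cases z)
    obtain \<phi> u where s_eq: "s = (\<phi>, u, E)" and \<phi>: "\<phi> \<in> hom B X Z"
      and u: "u \<in> hom ?F c (pull_ob \<phi> E)" and E: "E \<in> Ob (Fiber \<Phi> Z)"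
      using s unfolding z by (rule total_homE)
    obtain \<psi> v where t_eq0: "t = (\<psi>, v, E)" and \<psi>: "\<psi> \<in> hom B X Z"
      and v0: "v \<in> hom ?F b (pull_ob \<psi> E)"
      using t unfolding z by (rule total_homE)
    have "\<psi> = \<phi>" and uv: "u \<cdot>\<^bsub>?F\<^esub> g = v \<cdot>\<^bsub>?F\<^esub> f"
      using st comp_vert_right[OF g \<phi> u] comp_vert_right[OF f \<psi> v0] by (simp_all add: s_eq t_eq0)
    with t_eq0 v0 have t_eq: "t = (\<phi>, v, E)" and v: "v \<in> hom ?F b (pull_ob \<phi> E)"
      by simp_all
    obtain h where h: "h \<in> hom ?F d (pull_ob \<phi> E)" "h \<cdot>\<^bsub>?F\<^esub> f' = u" "h \<cdot>\<^bsub>?F\<^esub> g' = v"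
      and uniq: "\<And>k. \<lbrakk>k \<in> hom ?F d (pull_ob \<phi> E); k \<cdot>\<^bsub>?F\<^esub> f' = u; k \<cdot>\<^bsub>?F\<^esub> g' = v\<rbrakk> \<Longrightarrow> k = h"
      using univ[OF fX.hom_ob(2)[OF u] u v uv] by blast
    show "\<exists>!h. h \<in> hom Total (X, d) z \<and> h \<cdot>\<^bsub>Total\<^esub> vert X f' = s \<and> h \<cdot>\<^bsub>Total\<^esub> vert X g' = t"
    proof (rule ex1I)
      show "(\<phi>, h, E) \<in> hom Total (X, d) z \<and> (\<phi>, h, E) \<cdot>\<^bsub>Total\<^esub> vert X f' = s
          \<and> (\<phi>, h, E) \<cdot>\<^bsub>Total\<^esub> vert X g' = t"
        using comp_vert_right[OF f' \<phi> h(1)] comp_vert_right[OF g' \<phi> h(1)] h \<phi> E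
        by (simp add: z s_eq t_eq grothendieck_hom_iff)
      fix r assume r: "r \<in> hom Total (X, d) z \<and> r \<cdot>\<^bsub>Total\<^esub> vert X f' = s \<and> r \<cdot>\<^bsub>Total\<^esub> vert X g' = t"
      then have "r \<in> hom Total (X, d) (Z, E)"
        by (simp add: z)
      then obtain \<chi> k where r_eq: "r = (\<chi>, k, E)" and \<chi>: "\<chi> \<in> hom B X Z"
        and k: "k \<in> hom ?F d (pull_ob \<chi> E)"
        by (rule total_homE)
      have "\<chi> = \<phi>" "k \<cdot>\<^bsub>?F\<^esub> f' = u" "k \<cdot>\<^bsub>?F\<^esub> g' = v"
        using r comp_vert_right[OF f' \<chi> k] comp_vert_right[OF g' \<chi> k]
        by (simp_all add: r_eq s_eq t_eq)
      then show "r = (\<phi>, h, E)"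
        using uniq k r_eq by simp
    qed
  qed
qed

text \<open>
  Dually, an arrow \<open>(Z, E) \<rightarrow> (X, C)\<close> over \<open>\<phi>\<close> is an arrow \<open>E \<rightarrow> \<phi>\<^sup>* C\<close> of the fiber over \<open>Z\<close>, so
  here the pullback is first moved along \<open>\<phi>\<^sup>*\<close>, which preserves it as a right adjoint.
\<close>

lemma vert_pullback:
  assumes X: "X \<in> Ob B" and pb: "is_pullback (Fiber \<Phi> X) f g f' g'"
    and ra: "\<And>Z \<phi>. \<phi> \<in> hom B Z X \<Longrightarrow> is_right_adjoint (Fiber \<Phi> X) (Fiber \<Phi> Z) (Restr \<Phi> \<phi>)"
  shows "is_pullback Total (vert X f) (vert X g) (vert X f') (vert X g')"
  using pb
proof (rule is_pullbackD)
  let ?F = "Fiber \<Phi> X"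
  interpret fX: category ?F using fiber_category[OF X] .
  fix a b c d
  assume f: "f \<in> hom ?F b a" and g: "g \<in> hom ?F c a" and f': "f' \<in> hom ?F d c"
    and g': "g' \<in> hom ?F d b" and comm: "g \<cdot>\<^bsub>?F\<^esub> f' = f \<cdot>\<^bsub>?F\<^esub> g'"
  show ?thesis
  proof (rule is_pullbackI)
    show "vert X f \<in> hom Total (X, b) (X, a)" "vert X g \<in> hom Total (X, c) (X, a)"
      "vert X f' \<in> hom Total (X, d) (X, c)" "vert X g' \<in> hom Total (X, d) (X, b)"
      using vert_in_hom[OF X] f g f' g' by blast+
    show "vert X g \<cdot>\<^bsub>Total\<^esub> vert X f' = vert X f \<cdot>\<^bsub>Total\<^esub> vert X g'"
      using vert_comp[OF X f' g] vert_comp[OF X g' f] comm by simp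
    fix z s t
    assume s: "s \<in> hom Total z (X, c)" and t: "t \<in> hom Total z (X, b)"
      and st: "vert X g \<cdot>\<^bsub>Total\<^esub> s = vert X f \<cdot>\<^bsub>Total\<^esub> t"
    obtain Z E where z: "z = (Z, E)"
      by (cases z)
    let ?Z = "Fiber \<Phi> Z"
    obtain \<phi> u where s_eq: "s = (\<phi>, u, c)" and \<phi>: "\<phi> \<in> hom B Z X"
      and u: "u \<in> hom ?Z E (pull_ob \<phi> c)"
      using s unfolding z by (rule total_homE)
    obtain \<psi> v where t_eq0: "t = (\<psi>, v, b)" and \<psi>: "\<psi> \<in> hom B Z X"
      and v0: "v \<in> hom ?Z E (pull_ob \<psi> b)"
      using t unfolding z by (rule total_homE)
    have "\<psi> = \<phi>" and uv0: "pull_arr \<phi> g \<cdot>\<^bsub>?Z\<^esub> u = pull_arr \<psi> f \<cdot>\<^bsub>?Z\<^esub> v"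
      using st comp_vert_left[OF \<phi> g] comp_vert_left[OF \<psi> f] by (auto simp: s_eq t_eq0)
    with t_eq0 v0 have t_eq: "t = (\<phi>, v, b)" and v: "v \<in> hom ?Z E (pull_ob \<phi> b)"
      and uv: "pull_arr \<phi> g \<cdot>\<^bsub>?Z\<^esub> u = pull_arr \<phi> f \<cdot>\<^bsub>?Z\<^esub> v"
      by simp_all
    interpret fZ: category ?Z using fiber_category[OF base.hom_ob(1)[OF \<phi>]] .
    interpret pull: funct ?F ?Z "Restr \<Phi> \<phi>" using restr_functor[OF \<phi>] .
    have "\<exists>!h. h \<in> hom ?Z E (pull_ob \<phi> d) \<and> pull_arr \<phi> f' \<cdot>\<^bsub>?Z\<^esub> h = u \<and> pull_arr \<phi> g' \<cdot>\<^bsub>?Z\<^esub> h = v"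
      using pullback_universal[OF right_adjoint_preserves_pullback[OF ra[OF \<phi>] pb]
          pull.arr_in[OF f] pull.arr_in[OF g] pull.arr_in[OF f'] fZ.hom_ob(1)[OF u] u v uv] .
    then obtain h where h: "h \<in> hom ?Z E (pull_ob \<phi> d)" "pull_arr \<phi> f' \<cdot>\<^bsub>?Z\<^esub> h = u"
        "pull_arr \<phi> g' \<cdot>\<^bsub>?Z\<^esub> h = v"
      and uniq: "\<And>k. \<lbrakk>k \<in> hom ?Z E (pull_ob \<phi> d); pull_arr \<phi> f' \<cdot>\<^bsub>?Z\<^esub> k = u;
        pull_arr \<phi> g' \<cdot>\<^bsub>?Z\<^esub> k = v\<rbrakk> \<Longrightarrow> k = h"
      by blast
    show "\<exists>!h. h \<in> hom Total z (X, d) \<and> vert X f' \<cdot>\<^bsub>Total\<^esub> h = s \<and> vert X g' \<cdot>\<^bsub>Total\<^esub> h = t"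
    proof (rule ex1I)
      show "(\<phi>, h, d) \<in> hom Total z (X, d) \<and> vert X f' \<cdot>\<^bsub>Total\<^esub> (\<phi>, h, d) = s
          \<and> vert X g' \<cdot>\<^bsub>Total\<^esub> (\<phi>, h, d) = t"
        using comp_vert_left[OF \<phi> f'] comp_vert_left[OF \<phi> g'] h \<phi> fX.hom_ob(1)[OF f']
        by (simp add: z s_eq t_eq grothendieck_hom_iff)
      fix r assume r: "r \<in> hom Total z (X, d) \<and> vert X f' \<cdot>\<^bsub>Total\<^esub> r = s \<and> vert X g' \<cdot>\<^bsub>Total\<^esub> r = t"
      then have "r \<in> hom Total (Z, E) (X, d)"
        by (simp add: z)
      then obtain \<chi> k where r_eq: "r = (\<chi>, k, d)" and \<chi>: "\<chi> \<in> hom B Z X"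
        and k: "k \<in> hom ?Z E (pull_ob \<chi> d)"
        by (rule total_homE)
      have "\<chi> = \<phi>" "pull_arr \<chi> f' \<cdot>\<^bsub>?Z\<^esub> k = u" "pull_arr \<chi> g' \<cdot>\<^bsub>?Z\<^esub> k = v"
        using r comp_vert_left[OF \<chi> f'] comp_vert_left[OF \<chi> g']
        by (auto simp: r_eq s_eq t_eq)
      then show "r = (\<phi>, h, d)"
        using uniq k r_eq by simp
    qed
  qed
qed


section \<open>Objects that are initial or terminal in their fiber\<close>

lemma initial_source_eqI:
  assumes i: "is_initial (Fiber \<Phi> X) i"
    and s: "s \<in> hom Total (X, i) (Y, E)" and t: "t \<in> hom Total (X, i) (Y, E)" and eq: "fst s = fst t"
  shows "s = t"
proof -
  obtain \<phi> f where s': "s = (\<phi>, f, E)" and \<phi>: "\<phi> \<in> hom B X Y"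
    and f: "f \<in> hom (Fiber \<Phi> X) i (pull_ob \<phi> E)"
    using s by (rule total_homE)
  obtain \<psi> g where t': "t = (\<psi>, g, E)" and g: "g \<in> hom (Fiber \<Phi> X) i (pull_ob \<psi> E)"
    using t by (rule total_homE)
  have "pull_ob \<phi> E \<in> Ob (Fiber \<Phi> X)"
    using category.hom_ob(2)[OF fiber_category[OF base.hom_ob(1)[OF \<phi>]] f] .
  then have "f = g"
    using i f g eq s' t' unfolding is_initial_def by auto
  then show ?thesis
    using eq s' t' by simp
qed

lemma initial_source_lift:
  assumes i: "is_initial (Fiber \<Phi> X) i" and \<phi>: "\<phi> \<in> hom B X Y" and E: "E \<in> Ob (Fiber \<Phi> Y)"
  obtains t where "t \<in> hom Total (X, i) (Y, E)" "fst t = \<phi>"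
proof -
  have "pull_ob \<phi> E \<in> Ob (Fiber \<Phi> X)"
    using funct.ob_in[OF restr_functor[OF \<phi>] E] .
  then obtain f where "f \<in> hom (Fiber \<Phi> X) i (pull_ob \<phi> E)"
    using i unfolding is_initial_def by blast
  then show ?thesis
    using that[of "(\<phi>, f, E)"] \<phi> E by (simp add: grothendieck_hom_iff)
qed

text \<open>
  Sending \<open>X\<close> to \<open>(X, i)\<close>, with \<open>i\<close> initial in the fiber over \<open>X\<close>, is left adjoint to the projection
  to the base, because an arrow out of \<open>(X, i)\<close> is determined by its base arrow, which is
  arbitrary; so it preserves pushouts.
\<close>

lemma initial_lift_pushout:
  assumes po: "is_pushout B f g f' g'"
    and a: "is_initial (Fiber \<Phi> X) a" and b: "is_initial (Fiber \<Phi> Y) b"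
    and c: "is_initial (Fiber \<Phi> Z) c" and d: "is_initial (Fiber \<Phi> P) d"
    and F: "F \<in> hom Total (X, a) (Y, b)" "fst F = f" and G: "G \<in> hom Total (X, a) (Z, c)" "fst G = g"
    and F': "F' \<in> hom Total (Z, c) (P, d)" "fst F' = f'"
    and G': "G' \<in> hom Total (Y, b) (P, d)" "fst G' = g'"
  shows "is_pushout Total F G F' G'"
proof (rule is_pushoutI[OF F(1) G(1) F'(1) G'(1)])
  have comm: "f' \<cdot>\<^bsub>B\<^esub> g = g' \<cdot>\<^bsub>B\<^esub> f"
    using po by (simp add: is_pushout_def)
  show "F' \<cdot>\<^bsub>Total\<^esub> G = G' \<cdot>\<^bsub>Total\<^esub> F"
    by (rule initial_source_eqI[OF a total.comp_in[OF G(1) F'(1)] total.comp_in[OF F(1) G'(1)]])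
      (simp add: fst_total_comp F G F' G' comm)
  note f = fst_total_hom[OF F(1), unfolded F(2)] and g = fst_total_hom[OF G(1), unfolded G(2)]
    and f' = fst_total_hom[OF F'(1), unfolded F'(2)]
  fix z s t
  assume s: "s \<in> hom Total (Z, c) z" and t: "t \<in> hom Total (Y, b) z"
    and st: "s \<cdot>\<^bsub>Total\<^esub> G = t \<cdot>\<^bsub>Total\<^esub> F"
  obtain W E where z: "z = (W, E)"
    by (cases z)
  note s = s[unfolded z] and t = t[unfolded z]
  have E: "E \<in> Ob (Fiber \<Phi> W)"
    using total.hom_ob(2)[OF s] by (simp add: total_ob_iff)
  have "fst s \<cdot>\<^bsub>B\<^esub> g = fst t \<cdot>\<^bsub>B\<^esub> f"
    using arg_cong[OF st, of fst] by (simp add: fst_total_comp F G)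
  then have "\<exists>!h. h \<in> hom B P W \<and> h \<cdot>\<^bsub>B\<^esub> f' = fst s \<and> h \<cdot>\<^bsub>B\<^esub> g' = fst t"
    using pushout_universal[OF po f g f' base.hom_ob(2)[OF fst_total_hom[OF s]] fst_total_hom[OF s]
        fst_total_hom[OF t]] by blast
  then obtain h where h: "h \<in> hom B P W" "h \<cdot>\<^bsub>B\<^esub> f' = fst s" "h \<cdot>\<^bsub>B\<^esub> g' = fst t"
    and uniq: "\<And>k. \<lbrakk>k \<in> hom B P W; k \<cdot>\<^bsub>B\<^esub> f' = fst s; k \<cdot>\<^bsub>B\<^esub> g' = fst t\<rbrakk> \<Longrightarrow> k = h"
    by blast
  obtain r where r: "r \<in> hom Total (P, d) (W, E)" "fst r = h"
    using initial_source_lift[OF d h(1) E] .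
  show "\<exists>!h. h \<in> hom Total (P, d) z \<and> h \<cdot>\<^bsub>Total\<^esub> F' = s \<and> h \<cdot>\<^bsub>Total\<^esub> G' = t"
    unfolding z
  proof (rule ex1I)
    have "r \<cdot>\<^bsub>Total\<^esub> F' = s"
      by (rule initial_source_eqI[OF c total.comp_in[OF F'(1) r(1)] s])
        (simp add: fst_total_comp r F' h)
    moreover have "r \<cdot>\<^bsub>Total\<^esub> G' = t"
      by (rule initial_source_eqI[OF b total.comp_in[OF G'(1) r(1)] t])
        (simp add: fst_total_comp r G' h)
    ultimately show "r \<in> hom Total (P, d) (W, E) \<and> r \<cdot>\<^bsub>Total\<^esub> F' = s \<and> r \<cdot>\<^bsub>Total\<^esub> G' = t"
      using r by simp
    fix k assume k: "k \<in> hom Total (P, d) (W, E) \<and> k \<cdot>\<^bsub>Total\<^esub> F' = s \<and> k \<cdot>\<^bsub>Total\<^esub> G' = t"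
    have "fst k = h"
      using k fst_total_comp[of k F'] fst_total_comp[of k G'] F'(2) G'(2)
      by (intro uniq) (auto intro: fst_total_hom)
    then show "k = r"
      using k r by (intro initial_source_eqI[OF d]) auto
  qed
qed

text \<open>
  The pushout of \<open>(X, i) \<rightarrow> (Y, j)\<close> along the vertical arrow \<open>(X, i) \<rightarrow> (X, A)\<close> can be taken over \<open>Y\<close>
  itself. If \<open>(Q, D)\<close> is some pushout and \<open>q : Y \<rightarrow> Q\<close> the base arrow of its coprojection, then
  \<open>(Y, q\<^sup>* D)\<close> is also under the span, and the induced arrow \<open>(Q, D) \<rightarrow> (Y, q\<^sup>* D)\<close> is inverse to
  the cartesian arrow over \<open>q\<close>. In effect pushouts in the total category provide the
  pushforward of \<open>A\<close> along \<open>c\<close>.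
\<close>

lemma pushforward_along_initial:
  assumes po: "has_pushouts Total"
    and i: "is_initial (Fiber \<Phi> X) i"
    and f: "f \<in> hom Total (X, i) (Y, j)" and e: "e \<in> hom Total (X, i) (X, A)" "fst e = Ident B X"
  obtains D f' e' where "is_pushout Total f e f' e'"
    "f' \<in> hom Total (X, A) (Y, D)" "fst f' = fst f" "e' \<in> hom Total (Y, j) (Y, D)" "fst e' = Ident B Y"
proof -
  define c where "c = fst f"
  have c: "c \<in> hom B X Y"
    using fst_total_hom[OF f] by (simp add: c_def)
  note X = base.hom_ob(1)[OF c] and Y = base.hom_ob(2)[OF c]
  interpret fX: category "Fiber \<Phi> X" using fiber_category[OF X] .
  interpret fY: category "Fiber \<Phi> Y" using fiber_category[OF Y] .
  obtain k l where kl: "is_pushout Total f e k l"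
    using po f e unfolding has_pushouts_def hom_def by fastforce
  obtain Q D where QD: "Cod Total k = (Q, D)"
    by (cases "Cod Total k")
  have k: "k \<in> hom Total (X, A) (Q, D)" and l: "l \<in> hom Total (Y, j) (Q, D)"
    and comm: "k \<cdot>\<^bsub>Total\<^esub> e = l \<cdot>\<^bsub>Total\<^esub> f"
    using kl f e QD by (auto simp: is_pushout_def hom_def)
  have univ: "\<exists>!h. h \<in> hom Total (Q, D) z \<and> h \<cdot>\<^bsub>Total\<^esub> k = u \<and> h \<cdot>\<^bsub>Total\<^esub> l = v"
    if "u \<in> hom Total (X, A) z" "v \<in> hom Total (Y, j) z" "u \<cdot>\<^bsub>Total\<^esub> e = v \<cdot>\<^bsub>Total\<^esub> f" for z u v
    using pushout_universal[OF kl f e(1) k total.hom_ob(2)[OF that(1)] that] .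
  obtain \<kappa> k0 where k_eq0: "k = (\<kappa>, k0, D)" and \<kappa>: "\<kappa> \<in> hom B X Q"
    and k0': "k0 \<in> hom (Fiber \<Phi> X) A (pull_ob \<kappa> D)"
    using k by (rule total_homE)
  obtain q l0 where l_eq: "l = (q, l0, D)" and q: "q \<in> hom B Y Q"
    and l0: "l0 \<in> hom (Fiber \<Phi> Y) j (pull_ob q D)" and D: "D \<in> Ob (Fiber \<Phi> Q)"
    using l by (rule total_homE)
  have "\<kappa> = q \<cdot>\<^bsub>B\<^esub> c"
    using arg_cong[OF comm, of fst] base.comp_ident_right[OF \<kappa>]
    by (simp add: fst_total_comp e k_eq0 l_eq c_def)
  then have k_eq: "k = (q \<cdot>\<^bsub>B\<^esub> c, k0, D)"
    and k0: "k0 \<in> hom (Fiber \<Phi> X) A (pull_ob c (pull_ob q D))"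
    using k_eq0 k0' restr_comp_ob[OF c q D] by simp_all
  note Q = base.hom_ob(2)[OF q]
  interpret fQ: category "Fiber \<Phi> Q" using fiber_category[OF Q] .
  interpret cF: funct "Fiber \<Phi> Y" "Fiber \<Phi> X" "Restr \<Phi> c" using restr_functor[OF c] .
  interpret qF: funct "Fiber \<Phi> Q" "Fiber \<Phi> Y" "Restr \<Phi> q" using restr_functor[OF q] .
  define D' where "D' = pull_ob q D"
  have D': "D' \<in> Ob (Fiber \<Phi> Y)"
    using qF.ob_in[OF D] by (simp add: D'_def)
  define f' where "f' = (c, k0, D')"
  define e' where "e' = vert Y l0"
  define s where "s = (q, Ident (Fiber \<Phi> Y) D', D)"
  have f': "f' \<in> hom Total (X, A) (Y, D')"
    using c k0 D' by (simp add: f'_def D'_def grothendieck_hom_iff)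
  have e': "e' \<in> hom Total (Y, j) (Y, D')"
    using vert_in_hom[OF Y l0] by (simp add: e'_def D'_def)
  have s: "s \<in> hom Total (Y, D') (Q, D)"
    using q D fY.ident_in[OF D'] by (simp add: s_def grothendieck_hom_iff D'_def)
  have sf: "s \<cdot>\<^bsub>Total\<^esub> f' = k"
    using cF.on_ident[OF D'] fX.comp_ident_left k0
    by (simp add: s_def f'_def total_comp[OF c] k_eq D'_def)
  have se: "s \<cdot>\<^bsub>Total\<^esub> e' = l"
    using comp_vert_right[OF l0 q, of "Ident (Fiber \<Phi> Y) D'" D] fY.ident_in[OF D']
      fY.comp_ident_left[OF l0] by (simp add: s_def e'_def l_eq D'_def)
  have "f' \<cdot>\<^bsub>Total\<^esub> e = e' \<cdot>\<^bsub>Total\<^esub> f"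
    using total.comp_in[OF e(1) f'] total.comp_in[OF f e']
      base.comp_ident_right[OF c] base.comp_ident_left[OF c]
    by (intro initial_source_eqI[OF i])
      (auto simp: fst_total_comp e(2) f'_def e'_def vert_def c_def)
  then obtain t where t: "t \<in> hom Total (Q, D) (Y, D')" and tk: "t \<cdot>\<^bsub>Total\<^esub> k = f'"
    and tl: "t \<cdot>\<^bsub>Total\<^esub> l = e'"
    using univ[OF f' e'] by blast
  have id_Q: "Ident Total (Q, D) \<in> hom Total (Q, D) (Q, D)"
    using total.ident_in Q D by (simp add: total_ob_iff)
  have st: "s \<cdot>\<^bsub>Total\<^esub> t = Ident Total (Q, D)"
    using univ[OF k l comm] total.comp_in[OF t s] id_Q
      total.comp_assoc[OF k t s] total.comp_assoc[OF l t s]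
      total.comp_ident_left[OF k] total.comp_ident_left[OF l] tk tl sf se by metis
  obtain r d where t_eq: "t = (r, d, D')" and r: "r \<in> hom B Q Y"
    and d: "d \<in> hom (Fiber \<Phi> Q) D (pull_ob r D')"
    using t by (rule total_homE)
  interpret rF: funct "Fiber \<Phi> Y" "Fiber \<Phi> Q" "Restr \<Phi> r" using restr_functor[OF r] .
  \<comment> \<open>The arrow \<open>s\<close> is cartesian, so \<open>s \<cdot> t = id\<close> determines the vertical part of \<open>t\<close>.\<close>
  have d_id: "d = Ident (Fiber \<Phi> Q) D"
    using st rF.on_ident[OF D'] fQ.comp_ident_left[OF d]
    by (simp add: s_def t_eq total_comp[OF r]) (simp add: grothendieck_def)
  have rq: "r \<cdot>\<^bsub>B\<^esub> q = Ident B Y"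
    using arg_cong[OF tl, of fst] by (simp add: fst_total_comp t_eq l_eq e'_def vert_def)
  have ts: "t \<cdot>\<^bsub>Total\<^esub> s = Ident Total (Y, D')"
    using qF.on_ident[OF D] fY.comp_ident_left[OF fY.ident_in[OF D']]
    by (simp add: s_def t_eq total_comp[OF q] rq d_id D'_def[symmetric]) (simp add: grothendieck_def)
  have "is_pushout Total f e f' e'"
    using total.pushout_transport_iso[OF kl k t s st ts] by (simp add: tk tl)
  then show ?thesis
    using that f' e' by (simp add: f'_def e'_def vert_def c_def)
qed

lemma terminal_target_eqI:
  assumes ra: "\<And>Z \<phi>. \<phi> \<in> hom B Z X \<Longrightarrow> is_right_adjoint (Fiber \<Phi> X) (Fiber \<Phi> Z) (Restr \<Phi> \<phi>)"
    and T: "is_terminal (Fiber \<Phi> X) T"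
    and s: "s \<in> hom Total (Z, E) (X, T)" and t: "t \<in> hom Total (Z, E) (X, T)" and eq: "fst s = fst t"
  shows "s = t"
proof -
  obtain \<phi> f where s': "s = (\<phi>, f, T)" and \<phi>: "\<phi> \<in> hom B Z X"
    and f: "f \<in> hom (Fiber \<Phi> Z) E (pull_ob \<phi> T)"
    using s by (rule total_homE)
  obtain \<psi> g where t': "t = (\<psi>, g, T)" and g: "g \<in> hom (Fiber \<Phi> Z) E (pull_ob \<psi> T)"
    using t by (rule total_homE)
  have "E \<in> Ob (Fiber \<Phi> Z)"
    using category.hom_ob(1)[OF fiber_category[OF base.hom_ob(1)[OF \<phi>]] f] .
  then have "f = g"
    using right_adjoint_preserves_terminal[OF ra[OF \<phi>] T] f g eq s' t'
    unfolding is_terminal_def by auto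
  then show ?thesis
    using eq s' t' by simp
qed

lemma terminal_target_lift:
  assumes ra: "is_right_adjoint (Fiber \<Phi> X) (Fiber \<Phi> Z) (Restr \<Phi> \<phi>)"
    and T: "is_terminal (Fiber \<Phi> X) T" and \<phi>: "\<phi> \<in> hom B Z X" and E: "E \<in> Ob (Fiber \<Phi> Z)"
  obtains t where "t \<in> hom Total (Z, E) (X, T)" "fst t = \<phi>"
proof -
  obtain f where "f \<in> hom (Fiber \<Phi> Z) E (pull_ob \<phi> T)"
    using right_adjoint_preserves_terminal[OF ra T] E unfolding is_terminal_def by blast
  then show ?thesis
    using that[of "(\<phi>, f, T)"] \<phi> T by (simp add: grothendieck_hom_iff is_terminal_def)
qed

lemma terminal_lift_pullback:
  assumes ra: "\<And>X Y \<phi>. \<phi> \<in> hom B X Y \<Longrightarrow> is_right_adjoint (Fiber \<Phi> Y) (Fiber \<Phi> X) (Restr \<Phi> \<phi>)"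
    and pb: "is_pullback B f g f' g'"
    and a: "is_terminal (Fiber \<Phi> X) a" and b: "is_terminal (Fiber \<Phi> Y) b"
    and c: "is_terminal (Fiber \<Phi> Z) c" and d: "is_terminal (Fiber \<Phi> P) d"
    and F: "F \<in> hom Total (Y, b) (X, a)" "fst F = f" and G: "G \<in> hom Total (Z, c) (X, a)" "fst G = g"
    and F': "F' \<in> hom Total (P, d) (Z, c)" "fst F' = f'"
    and G': "G' \<in> hom Total (P, d) (Y, b)" "fst G' = g'"
  shows "is_pullback Total F G F' G'"
proof (rule is_pullbackI[OF F(1) G(1) F'(1) G'(1)])
  have comm: "g \<cdot>\<^bsub>B\<^esub> f' = f \<cdot>\<^bsub>B\<^esub> g'"
    using pb by (simp add: is_pullback_def)
  show "G \<cdot>\<^bsub>Total\<^esub> F' = F \<cdot>\<^bsub>Total\<^esub> G'"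
    by (rule terminal_target_eqI[OF ra a total.comp_in[OF F'(1) G(1)] total.comp_in[OF G'(1) F(1)]])
      (simp_all add: fst_total_comp F G F' G' comm)
  note f = fst_total_hom[OF F(1), unfolded F(2)] and g = fst_total_hom[OF G(1), unfolded G(2)]
    and f' = fst_total_hom[OF F'(1), unfolded F'(2)]
  fix z s t
  assume s: "s \<in> hom Total z (Z, c)" and t: "t \<in> hom Total z (Y, b)"
    and st: "G \<cdot>\<^bsub>Total\<^esub> s = F \<cdot>\<^bsub>Total\<^esub> t"
  obtain W E where z: "z = (W, E)"
    by (cases z)
  note s = s[unfolded z] and t = t[unfolded z]
  have E: "E \<in> Ob (Fiber \<Phi> W)"
    using total.hom_ob(1)[OF s] by (simp add: total_ob_iff)
  have "g \<cdot>\<^bsub>B\<^esub> fst s = f \<cdot>\<^bsub>B\<^esub> fst t"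
    using arg_cong[OF st, of fst] by (simp add: fst_total_comp F G)
  then have "\<exists>!h. h \<in> hom B W P \<and> f' \<cdot>\<^bsub>B\<^esub> h = fst s \<and> g' \<cdot>\<^bsub>B\<^esub> h = fst t"
    using pullback_universal[OF pb f g f' base.hom_ob(1)[OF fst_total_hom[OF s]] fst_total_hom[OF s]
        fst_total_hom[OF t]] by blast
  then obtain h where h: "h \<in> hom B W P" "f' \<cdot>\<^bsub>B\<^esub> h = fst s" "g' \<cdot>\<^bsub>B\<^esub> h = fst t"
    and uniq: "\<And>k. \<lbrakk>k \<in> hom B W P; f' \<cdot>\<^bsub>B\<^esub> k = fst s; g' \<cdot>\<^bsub>B\<^esub> k = fst t\<rbrakk> \<Longrightarrow> k = h"
    by blast
  obtain r where r: "r \<in> hom Total (W, E) (P, d)" "fst r = h"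
    using terminal_target_lift[OF ra[OF h(1)] d h(1) E] .
  show "\<exists>!h. h \<in> hom Total z (P, d) \<and> F' \<cdot>\<^bsub>Total\<^esub> h = s \<and> G' \<cdot>\<^bsub>Total\<^esub> h = t"
    unfolding z
  proof (rule ex1I)
    have "F' \<cdot>\<^bsub>Total\<^esub> r = s"
      by (rule terminal_target_eqI[OF ra c total.comp_in[OF r(1) F'(1)] s])
        (simp_all add: fst_total_comp r F' h)
    moreover have "G' \<cdot>\<^bsub>Total\<^esub> r = t"
      by (rule terminal_target_eqI[OF ra b total.comp_in[OF r(1) G'(1)] t])
        (simp_all add: fst_total_comp r G' h)
    ultimately show "r \<in> hom Total (W, E) (P, d) \<and> F' \<cdot>\<^bsub>Total\<^esub> r = s \<and> G' \<cdot>\<^bsub>Total\<^esub> r = t"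
      using r by simp
    fix k assume k: "k \<in> hom Total (W, E) (P, d) \<and> F' \<cdot>\<^bsub>Total\<^esub> k = s \<and> G' \<cdot>\<^bsub>Total\<^esub> k = t"
    have "fst k = h"
      using k fst_total_comp[of F' k] fst_total_comp[of G' k] F'(2) G'(2)
      by (intro uniq) (auto intro: fst_total_hom)
    then show "k = r"
      using k r by (intro terminal_target_eqI[OF ra d]) auto
  qed
qed

end


section \<open>Descent of properness\<close>

context homotopically_structured
begin

abbreviation Global_classes :: "('m \<times> 'f \<times> 'a) classes" where
  "Global_classes \<equiv> global_classes B \<Phi> H V"

lemma global_weq_iff:
  assumes "\<phi> \<in> hom B X Y"
  shows "(\<phi>, f, A) \<in> weq Global_classes \<longleftrightarrow> (\<phi>, f, A) \<in> Arr Total \<and> \<phi> \<in> weq H \<and> f \<in> weq (V X)"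
  using assms by (simp add: global_classes_def hom_def)

lemma global_fib_iff:
  assumes "\<phi> \<in> hom B X Y"
  shows "(\<phi>, f, A) \<in> fib Global_classes \<longleftrightarrow> (\<phi>, f, A) \<in> Arr Total \<and> \<phi> \<in> fib H \<and> f \<in> fib (V X)"
  using assms by (simp add: global_classes_def hom_def)

lemma global_trivial_fibrationE:
  assumes "t \<in> trivial_fibrations Global_classes"
  obtains \<psi> p X Y E D where "t = (\<psi>, p, D)" "t \<in> hom Total (X, E) (Y, D)" "\<psi> \<in> hom B X Y"
    "p \<in> hom (Fiber \<Phi> X) E (pull_ob \<psi> D)" "D \<in> Ob (Fiber \<Phi> Y)"
    "\<psi> \<in> trivial_fibrations H" "p \<in> trivial_fibrations (V X)"
proof -
  have "t \<in> Arr Total"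
    using assms by (auto simp: trivial_fibrations_def global_classes_def)
  moreover obtain X E Y D where XE: "Dom Total t = (X, E)" "Cod Total t = (Y, D)"
    by (metis surj_pair)
  ultimately have t: "t \<in> hom Total (X, E) (Y, D)"
    by (simp add: hom_def)
  then obtain \<psi> p where t_eq: "t = (\<psi>, p, D)" and \<psi>: "\<psi> \<in> hom B X Y"
    and p: "p \<in> hom (Fiber \<Phi> X) E (pull_ob \<psi> D)" and D: "D \<in> Ob (Fiber \<Phi> Y)"
    by (rule total_homE)
  have "\<psi> \<in> trivial_fibrations H" "p \<in> trivial_fibrations (V X)"
    using assms global_weq_iff[OF \<psi>] global_fib_iff[OF \<psi>] by (auto simp: trivial_fibrations_def t_eq)
  then show ?thesis
    using that t_eq t \<psi> p D by blast
qed

text \<open>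
  A lifting problem of \<open>(id, c)\<close> against \<open>(\<psi>, p)\<close>, with upper arrow over \<open>\<alpha>\<close>, is a lifting problem
  of \<open>c\<close> against \<open>\<alpha>\<^sup>* p\<close> in the fiber; this is where \<open>\<alpha>\<^sup>*\<close> has to preserve trivial fibrations.
\<close>

lemma vert_cofibration:
  assumes restr: "restr_preserves_trivial_fibrations B \<Phi> V"
    and X: "X \<in> Ob B" and c_cof: "c \<in> cofibrations (Fiber \<Phi> X) (V X)"
  shows "vert X c \<in> cofibrations Total Global_classes"
proof -
  let ?F = "Fiber \<Phi> X"
  obtain A C where c: "c \<in> hom ?F A C"
    using c_cof by (auto simp: cofibrations_def hom_def)
  note vc = vert_in_hom[OF X c]
  have "has_llp Total (vert X c) t" if "t \<in> trivial_fibrations Global_classes" for t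
    using that
  proof (rule global_trivial_fibrationE)
    fix \<psi> p Y Z E D
    assume t_eq: "t = (\<psi>, p, D)" and t: "t \<in> hom Total (Y, E) (Z, D)" and \<psi>: "\<psi> \<in> hom B Y Z"
      and p: "p \<in> hom (Fiber \<Phi> Y) E (pull_ob \<psi> D)" and D: "D \<in> Ob (Fiber \<Phi> Z)"
      and p_triv: "p \<in> trivial_fibrations (V Y)"
    show ?thesis
      unfolding has_llp_def
    proof (intro ballI impI)
      fix u v
      assume "u \<in> hom Total (Dom Total (vert X c)) (Dom Total t)"
        "v \<in> hom Total (Cod Total (vert X c)) (Cod Total t)"
        and sq: "t \<cdot>\<^bsub>Total\<^esub> u = v \<cdot>\<^bsub>Total\<^esub> vert X c"
      then have u: "u \<in> hom Total (X, A) (Y, E)" and v: "v \<in> hom Total (X, C) (Z, D)"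
        using vc t by (simp_all add: hom_def)
      obtain \<alpha> a where u_eq: "u = (\<alpha>, a, E)" and \<alpha>: "\<alpha> \<in> hom B X Y"
        and a: "a \<in> hom ?F A (pull_ob \<alpha> E)" and E: "E \<in> Ob (Fiber \<Phi> Y)"
        using u by (rule total_homE)
      obtain \<beta> b where v_eq: "v = (\<beta>, b, D)" and \<beta>: "\<beta> \<in> hom B X Z"
        and b0: "b \<in> hom ?F C (pull_ob \<beta> D)"
        using v by (rule total_homE)
      have \<beta>_eq: "\<beta> = \<psi> \<cdot>\<^bsub>B\<^esub> \<alpha>" and ab: "pull_arr \<alpha> p \<cdot>\<^bsub>?F\<^esub> a = b \<cdot>\<^bsub>?F\<^esub> c"
        using sq total_comp[OF \<alpha>] comp_vert_right[OF c \<beta> b0] by (simp_all add: t_eq u_eq v_eq)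
      have b: "b \<in> hom ?F C (pull_ob \<alpha> (pull_ob \<psi> D))"
        using b0 restr_comp_ob[OF \<alpha> \<psi> D] by (simp add: \<beta>_eq)
      have "pull_arr \<alpha> p \<in> trivial_fibrations (V X)"
        using restr p_triv \<alpha> base.hom_ob[OF \<alpha>]
        unfolding restr_preserves_trivial_fibrations_def by blast
      then have "has_llp ?F c (pull_arr \<alpha> p)"
        using c_cof by (simp add: cofibrations_def)
      then obtain h where h: "h \<in> hom ?F C (pull_ob \<alpha> E)" "h \<cdot>\<^bsub>?F\<^esub> c = a" "pull_arr \<alpha> p \<cdot>\<^bsub>?F\<^esub> h = b"
        using has_llp_lift[OF _ c funct.arr_in[OF restr_functor[OF \<alpha>] p] a b ab] by blast
      have "(\<alpha>, h, E) \<in> hom Total (X, C) (Y, E)"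
        using \<alpha> h E by (simp add: grothendieck_hom_iff)
      moreover have "(\<alpha>, h, E) \<cdot>\<^bsub>Total\<^esub> vert X c = u"
        using comp_vert_right[OF c \<alpha> h(1)] h by (simp add: u_eq)
      moreover have "t \<cdot>\<^bsub>Total\<^esub> (\<alpha>, h, E) = v"
        using h by (simp add: t_eq v_eq total_comp[OF \<alpha>] \<beta>_eq)
      ultimately show "\<exists>h\<in>hom Total (Cod Total (vert X c)) (Dom Total t).
          h \<cdot>\<^bsub>Total\<^esub> vert X c = u \<and> t \<cdot>\<^bsub>Total\<^esub> h = v"
        using vc t by (auto simp: hom_def)
    qed
  qed
  then show ?thesis
    using vc by (simp add: cofibrations_def hom_def)
qed

text \<open>
  A left adjoint takes cofibrations to cofibrations when its right adjoint, here the projection to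
  the base, preserves trivial fibrations.
\<close>

lemma initial_lift_cofibration:
  assumes c_cof: "c \<in> cofibrations B H"
    and i: "is_initial (Fiber \<Phi> X) i" and j: "is_initial (Fiber \<Phi> Y) j"
    and f: "f \<in> hom Total (X, i) (Y, j)" "fst f = c"
  shows "f \<in> cofibrations Total Global_classes"
proof -
  have c: "c \<in> hom B X Y"
    using fst_total_hom[OF f(1)] f(2) by simp
  have "has_llp Total f t" if "t \<in> trivial_fibrations Global_classes" for t
    using that
  proof (rule global_trivial_fibrationE)
    fix \<psi> p Z Q E D
    assume t_eq: "t = (\<psi>, p, D)" and t: "t \<in> hom Total (Z, E) (Q, D)" and \<psi>: "\<psi> \<in> hom B Z Q"
      and \<psi>_triv: "\<psi> \<in> trivial_fibrations H"
    show ?thesis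
      unfolding has_llp_def
    proof (intro ballI impI)
      fix u v
      assume "u \<in> hom Total (Dom Total f) (Dom Total t)" "v \<in> hom Total (Cod Total f) (Cod Total t)"
        and sq: "t \<cdot>\<^bsub>Total\<^esub> u = v \<cdot>\<^bsub>Total\<^esub> f"
      then have u: "u \<in> hom Total (X, i) (Z, E)" and v: "v \<in> hom Total (Y, j) (Q, D)"
        using f t by (simp_all add: hom_def)
      have "\<psi> \<cdot>\<^bsub>B\<^esub> fst u = fst v \<cdot>\<^bsub>B\<^esub> c"
        using arg_cong[OF sq, of fst] by (simp add: fst_total_comp t_eq f)
      moreover have "has_llp B c \<psi>"
        using c_cof \<psi>_triv by (simp add: cofibrations_def)
      ultimately obtain h where h: "h \<in> hom B Y Z" "h \<cdot>\<^bsub>B\<^esub> c = fst u" "\<psi> \<cdot>\<^bsub>B\<^esub> h = fst v"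
        using has_llp_lift[OF _ c \<psi> fst_total_hom[OF u] fst_total_hom[OF v]] by blast
      have "E \<in> Ob (Fiber \<Phi> Z)"
        using total.hom_ob(1)[OF t] by (simp add: total_ob_iff)
      then obtain r where r: "r \<in> hom Total (Y, j) (Z, E)" "fst r = h"
        using initial_source_lift[OF j h(1)] by blast
      have "r \<cdot>\<^bsub>Total\<^esub> f = u"
        by (rule initial_source_eqI[OF i total.comp_in[OF f(1) r(1)] u])
          (simp add: fst_total_comp r f h)
      moreover have "t \<cdot>\<^bsub>Total\<^esub> r = v"
        by (rule initial_source_eqI[OF j total.comp_in[OF r(1) t] v])
          (simp add: fst_total_comp r t_eq h)
      ultimately show "\<exists>h\<in>hom Total (Cod Total f) (Dom Total t). h \<cdot>\<^bsub>Total\<^esub> f = u \<and> t \<cdot>\<^bsub>Total\<^esub> h = v"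
        using r f t by (intro bexI[of _ r]) (simp_all add: hom_def)
    qed
  qed
  then show ?thesis
    using f by (simp add: cofibrations_def hom_def)
qed

lemma vert_weq_iff:
  assumes idw: "contains_identities B (weq H)" and X: "X \<in> Ob B" and f: "f \<in> Arr (Fiber \<Phi> X)"
  shows "vert X f \<in> weq Global_classes \<longleftrightarrow> f \<in> weq (V X)"
  using global_weq_iff[OF base.ident_in[OF X]] vert_in_hom[OF X homE[OF f]] idw X
  by (simp add: vert_def contains_identities_def hom_def)

lemma vert_fib:
  assumes idf: "contains_identities B (fib H)" and X: "X \<in> Ob B" and f: "f \<in> fib (V X)"
  shows "vert X f \<in> fib Global_classes"
proof -
  have "f \<in> Arr (Fiber \<Phi> X)"
    using vertical_fib[OF X] f by blast
  then show ?thesis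
    using global_fib_iff[OF base.ident_in[OF X]] vert_in_hom[OF X homE] idf X f
    by (simp add: vert_def contains_identities_def hom_def)
qed

lemma fiber_left_proper:
  assumes idw: "contains_identities B (weq H)"
    and restr: "restr_preserves_trivial_fibrations B \<Phi> V"
    and proper: "left_proper Total Global_classes" and X: "X \<in> Ob B"
  shows "left_proper (Fiber \<Phi> X) (V X)"
  unfolding left_proper_def
proof (intro allI impI, elim conjE)
  fix w c w' c'
  assume po: "is_pushout (Fiber \<Phi> X) w c w' c'" and w: "w \<in> weq (V X)"
    and c: "c \<in> cofibrations (Fiber \<Phi> X) (V X)"
  have "w \<in> Arr (Fiber \<Phi> X)" "w' \<in> Arr (Fiber \<Phi> X)"
    using po by (simp_all add: is_pushout_def)
  then show "w' \<in> weq (V X)"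
    using proper vert_pushout[OF X po] vert_cofibration[OF restr X c] vert_weq_iff[OF idw X] w
    unfolding left_proper_def by blast
qed

lemma fiber_right_proper:
  assumes idw: "contains_identities B (weq H)" and idf: "contains_identities B (fib H)"
    and ra: "\<And>Z \<phi>. \<phi> \<in> hom B Z X \<Longrightarrow> is_right_adjoint (Fiber \<Phi> X) (Fiber \<Phi> Z) (Restr \<Phi> \<phi>)"
    and proper: "right_proper Total Global_classes" and X: "X \<in> Ob B"
  shows "right_proper (Fiber \<Phi> X) (V X)"
  unfolding right_proper_def
proof (intro allI impI, elim conjE)
  fix w p w' p'
  assume pb: "is_pullback (Fiber \<Phi> X) w p w' p'" and w: "w \<in> weq (V X)" and p: "p \<in> fib (V X)"
  have "w \<in> Arr (Fiber \<Phi> X)" "w' \<in> Arr (Fiber \<Phi> X)"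
    using pb by (simp_all add: is_pullback_def)
  then show "w' \<in> weq (V X)"
    using proper vert_pullback[OF X pb ra] vert_fib[OF idf X p] vert_weq_iff[OF idw X] w
    unfolding right_proper_def by blast
qed

text \<open>
  The vertical part of the cartesian arrow over \<open>\<phi>\<close> is an identity, so its global class is
  governed by \<open>\<phi>\<close>.
\<close>

lemma cartesian_lift:
  assumes \<phi>: "\<phi> \<in> hom B X Y" and E: "E \<in> Ob (Fiber \<Phi> Y)"
  defines "t \<equiv> (\<phi>, Ident (Fiber \<Phi> X) (pull_ob \<phi> E), E)"
  shows "t \<in> hom Total (X, pull_ob \<phi> E) (Y, E)"
    and "contains_identities (Fiber \<Phi> X) (weq (V X)) \<Longrightarrow> \<phi> \<in> weq H \<Longrightarrow> t \<in> weq Global_classes"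
    and "contains_identities (Fiber \<Phi> X) (fib (V X)) \<Longrightarrow> \<phi> \<in> fib H \<Longrightarrow> t \<in> fib Global_classes"
proof -
  have E': "pull_ob \<phi> E \<in> Ob (Fiber \<Phi> X)"
    using funct.ob_in[OF restr_functor[OF \<phi>] E] .
  show t: "t \<in> hom Total (X, pull_ob \<phi> E) (Y, E)"
    using category.ident_in[OF fiber_category[OF base.hom_ob(1)[OF \<phi>]] E'] \<phi> E
    by (simp add: t_def grothendieck_hom_iff)
  then have "t \<in> Arr Total"
    by (simp add: hom_def)
  then show "contains_identities (Fiber \<Phi> X) (weq (V X)) \<Longrightarrow> \<phi> \<in> weq H \<Longrightarrow> t \<in> weq Global_classes"
    and "contains_identities (Fiber \<Phi> X) (fib (V X)) \<Longrightarrow> \<phi> \<in> fib H \<Longrightarrow> t \<in> fib Global_classes"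
    using global_weq_iff[OF \<phi>] global_fib_iff[OF \<phi>] E'
    by (simp_all add: t_def contains_identities_def)
qed

text \<open>
  The square lifted to initial objects has \<open>i \<rightarrow> w\<^sup>* i'\<close> as the vertical part of the arrow
  \<open>(X, i) \<rightarrow> (X', i')\<close> over \<open>w\<close>, and this may fail to be a weak equivalence. Factor the arrow as the
  vertical \<open>(X, i) \<rightarrow> (X, w\<^sup>* i')\<close> followed by the cartesian arrow over \<open>w\<close>, which is a weak
  equivalence, and push the cofibration over \<open>c\<close> forward along the first factor. By the pasting
  law the second factor is then pushed out along a cofibration, and the result lies over \<open>w'\<close>.
\<close>

lemma base_left_proper:
  assumes idv: "\<forall>X\<in>Ob B. contains_identities (Fiber \<Phi> X) (weq (V X))"
    and po: "has_pushouts Total" and proper: "left_proper Total Global_classes"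
    and init: "\<forall>X\<in>Ob B. \<exists>i. is_initial (Fiber \<Phi> X) i"
  shows "left_proper B H"
  unfolding left_proper_def
proof (intro allI impI, elim conjE)
  fix w c w' c'
  assume sq: "is_pushout B w c w' c'" and w_weq: "w \<in> weq H" and c_cof: "c \<in> cofibrations B H"
  obtain X X' Y P where w: "w \<in> hom B X X'" and c: "c \<in> hom B X Y"
    and w': "w' \<in> hom B Y P" and c': "c' \<in> hom B X' P" and comm: "w' \<cdot>\<^bsub>B\<^esub> c = c' \<cdot>\<^bsub>B\<^esub> w"
    using sq by (rule is_pushoutD)
  note obs = base.hom_ob[OF w] base.hom_ob[OF w']
  obtain i i' j k where i: "is_initial (Fiber \<Phi> X) i" and i': "is_initial (Fiber \<Phi> X') i'"
    and j: "is_initial (Fiber \<Phi> Y) j" and k: "is_initial (Fiber \<Phi> P) k"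
    using init obs by metis
  have i'_ob: "i' \<in> Ob (Fiber \<Phi> X')" and j_ob: "j \<in> Ob (Fiber \<Phi> Y)" and k_ob: "k \<in> Ob (Fiber \<Phi> P)"
    using i' j k by (simp_all add: is_initial_def)
  obtain Lc where Lc: "Lc \<in> hom Total (X, i) (Y, j)" "fst Lc = c"
    using initial_source_lift[OF i c j_ob] .
  obtain Lw' where Lw': "Lw' \<in> hom Total (Y, j) (P, k)" "fst Lw' = w'"
    using initial_source_lift[OF j w' k_ob] .
  obtain Lc' where Lc': "Lc' \<in> hom Total (X', i') (P, k)" "fst Lc' = c'"
    using initial_source_lift[OF i' c' k_ob] .
  define A where "A = pull_ob w i'"
  have A: "A \<in> Ob (Fiber \<Phi> X)"
    using funct.ob_in[OF restr_functor[OF w] i'_ob] by (simp add: A_def)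
  obtain e where e: "e \<in> hom Total (X, i) (X, A)" "fst e = Ident B X"
    using initial_source_lift[OF i base.ident_in[OF obs(1)] A] .
  define cw where "cw = (w, Ident (Fiber \<Phi> X) A, i')"
  have cw: "cw \<in> hom Total (X, A) (X', i')" and cw_weq: "cw \<in> weq Global_classes" and fst_cw: "fst cw = w"
    using cartesian_lift[OF w i'_ob] idv obs w_weq by (simp_all add: cw_def A_def)
  obtain D f' e' where left: "is_pushout Total Lc e f' e'"
    and f': "f' \<in> hom Total (X, A) (Y, D)" "fst f' = c"
    and e': "e' \<in> hom Total (Y, j) (Y, D)" "fst e' = Ident B Y"
    using pushforward_along_initial[OF po i Lc(1) e] Lc(2) by metis
  have cwe: "cw \<cdot>\<^bsub>Total\<^esub> e \<in> hom Total (X, i) (X', i')" "fst (cw \<cdot>\<^bsub>Total\<^esub> e) = w"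
    using total.comp_in[OF e(1) cw] base.comp_ident_right[OF w]
    by (simp_all add: fst_total_comp fst_cw e)
  have outer: "is_pushout Total (cw \<cdot>\<^bsub>Total\<^esub> e) Lc Lw' Lc'"
    using initial_lift_pushout[OF sq i i' j k cwe Lc Lw' Lc'] .
  have Lcw: "Lc' \<cdot>\<^bsub>Total\<^esub> cw \<in> hom Total (X, A) (P, k)"
    using total.comp_in[OF cw Lc'(1)] .
  have "Lc' \<cdot>\<^bsub>Total\<^esub> cw \<cdot>\<^bsub>Total\<^esub> e = Lw' \<cdot>\<^bsub>Total\<^esub> Lc"
    using outer total.comp_assoc[OF e(1) cw Lc'(1)] by (simp add: is_pushout_def)
  then obtain m where m: "m \<in> hom Total (Y, D) (P, k)" "m \<cdot>\<^bsub>Total\<^esub> f' = Lc' \<cdot>\<^bsub>Total\<^esub> cw"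
    "m \<cdot>\<^bsub>Total\<^esub> e' = Lw'"
    using pushout_universal[OF left Lc(1) e(1) f'(1) total.hom_ob(2)[OF Lcw] Lcw Lw'(1)] by blast
  have "is_pushout Total cw f' m Lc'"
    using total.pushout_cancel_left[OF left _ Lc(1) e(1) f'(1) e'(1) cw m(1) Lc'(1) m(2)] outer m(3)
    by simp
  moreover have "f' \<in> cofibrations Total Global_classes"
    using total.cofibration_pushout[OF left initial_lift_cofibration[OF c_cof i j Lc]]
    by (auto simp: trivial_fibrations_def global_classes_def)
  ultimately have "m \<in> weq Global_classes"
    using proper cw_weq unfolding left_proper_def by blast
  moreover have "fst m = w'"
    using arg_cong[OF m(3), of fst] base.comp_ident_right[OF fst_total_hom[OF m(1)]]
    by (simp add: fst_total_comp e' Lw')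
  ultimately show "w' \<in> weq H"
    by (auto simp: global_classes_def)
qed

lemma base_right_proper:
  assumes idv: "\<forall>X\<in>Ob B. contains_identities (Fiber \<Phi> X) (weq (V X))"
    and idf: "\<forall>X\<in>Ob B. contains_identities (Fiber \<Phi> X) (fib (V X))"
    and ra: "\<And>X Y \<phi>. \<phi> \<in> hom B X Y \<Longrightarrow> is_right_adjoint (Fiber \<Phi> Y) (Fiber \<Phi> X) (Restr \<Phi> \<phi>)"
    and proper: "right_proper Total Global_classes"
    and terminals: "\<forall>X\<in>Ob B. \<exists>t. is_terminal (Fiber \<Phi> X) t"
  shows "right_proper B H"
  unfolding right_proper_def
proof (intro allI impI, elim conjE)
  fix w p w' p'
  assume sq: "is_pullback B w p w' p'" and w_weq: "w \<in> weq H" and p_fib: "p \<in> fib H"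
  obtain X Y Z P where w: "w \<in> hom B Y X" and p: "p \<in> hom B Z X"
    and w': "w' \<in> hom B P Z" and p': "p' \<in> hom B P Y"
    using sq by (rule is_pullbackD)
  note obs = base.hom_ob[OF w] base.hom_ob[OF w']
  obtain a where a: "is_terminal (Fiber \<Phi> X) a"
    using terminals obs by blast
  \<comment> \<open>Pulling \<open>a\<close> back gives terminal objects, between which the cartesian arrows run.\<close>
  have b: "is_terminal (Fiber \<Phi> Y) (pull_ob w a)" and c: "is_terminal (Fiber \<Phi> Z) (pull_ob p a)"
    using right_adjoint_preserves_terminal[OF ra] w p a by blast+
  then have d: "is_terminal (Fiber \<Phi> P) (pull_ob w' (pull_ob p a))"
    using right_adjoint_preserves_terminal[OF ra] w' by blast
  have term_ob: "t \<in> Ob C" if "is_terminal C t" for t and C :: "('a, 'f) cat"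
    using that by (simp add: is_terminal_def)
  note lw = cartesian_lift[OF w term_ob[OF a]] and lp = cartesian_lift[OF p term_ob[OF a]]
    and lw' = cartesian_lift[OF w' term_ob[OF c]]
  obtain q where q: "q \<in> hom Total (P, pull_ob w' (pull_ob p a)) (Y, pull_ob w a)" "fst q = p'"
    using terminal_target_lift[OF ra[OF p'] b p' term_ob[OF d]] .
  have "(w', Ident (Fiber \<Phi> P) (pull_ob w' (pull_ob p a)), pull_ob p a) \<in> weq Global_classes"
    using proper terminal_lift_pullback[OF ra sq a b c d lw(1) _ lp(1) _ lw'(1) _ q]
      lw(2) lp(3) idv idf obs base.hom_ob[OF p] w_weq p_fib
    unfolding right_proper_def by fastforce
  then show "w' \<in> weq H"
    by (simp add: global_classes_def)
qed

end

theorem theorem3p18: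
  fixes B :: "('o, 'm) cat"
    and \<Phi> :: "('o, 'm, 'a, 'f) cat_functor"
    and H :: "'m classes"
    and V :: "'o \<Rightarrow> 'f classes"
  assumes "homotopically_structured B \<Phi> H V"
    and "contains_identities B (weq H)"
    and "\<forall>X\<in>Ob B. contains_identities (Fiber \<Phi> X) (weq (V X))"
  shows
    "(has_pushouts (grothendieck B \<Phi>) \<and> (\<forall>X\<in>Ob B. has_pushouts (Fiber \<Phi> X)) \<and>
      left_proper (grothendieck B \<Phi>) (global_classes B \<Phi> H V) \<longrightarrow>
        (restr_preserves_trivial_fibrations B \<Phi> V \<longrightarrow>
          (\<forall>X\<in>Ob B. left_proper (Fiber \<Phi> X) (V X))) \<and>
        ((\<forall>X\<in>Ob B. \<exists>i. is_initial (Fiber \<Phi> X) i) \<longrightarrow> left_proper B H)) \<and>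
     (contains_identities B (fib H) \<and>
      (\<forall>X\<in>Ob B. contains_identities (Fiber \<Phi> X) (fib (V X))) \<and>
      has_pullbacks (grothendieck B \<Phi>) \<and> (\<forall>X\<in>Ob B. has_pullbacks (Fiber \<Phi> X)) \<and>
      (\<forall>X\<in>Ob B. \<forall>Y\<in>Ob B. \<forall>\<phi>\<in>hom B X Y.
        is_right_adjoint (Fiber \<Phi> Y) (Fiber \<Phi> X) (Restr \<Phi> \<phi>)) \<and>
      right_proper (grothendieck B \<Phi>) (global_classes B \<Phi> H V) \<longrightarrow>
        (\<forall>X\<in>Ob B. right_proper (Fiber \<Phi> X) (V X)) \<and>
        ((\<forall>X\<in>Ob B. \<exists>t. is_terminal (Fiber \<Phi> X) t) \<longrightarrow> right_proper B H))"
proof -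
  interpret homotopically_structured B \<Phi> H V
    by (rule assms(1))
  have fiber_right: "right_proper (Fiber \<Phi> X) (V X)"
    if "\<forall>X\<in>Ob B. \<forall>Y\<in>Ob B. \<forall>\<phi>\<in>hom B X Y. is_right_adjoint (Fiber \<Phi> Y) (Fiber \<Phi> X) (Restr \<Phi> \<phi>)"
      "contains_identities B (fib H)" "right_proper Total Global_classes" "X \<in> Ob B" for X
    using that base.hom_ob by (intro fiber_right_proper[OF assms(2)]) blast+
  have base_right: "right_proper B H"
    if "\<forall>X\<in>Ob B. \<forall>Y\<in>Ob B. \<forall>\<phi>\<in>hom B X Y. is_right_adjoint (Fiber \<Phi> Y) (Fiber \<Phi> X) (Restr \<Phi> \<phi>)"
      "\<forall>X\<in>Ob B. contains_identities (Fiber \<Phi> X) (fib (V X))" "right_proper Total Global_classes"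
      "\<forall>X\<in>Ob B. \<exists>t. is_terminal (Fiber \<Phi> X) t"
    using that base.hom_ob by (intro base_right_proper[OF assms(3)]) blast+
  show ?thesis
    using fiber_left_proper[OF assms(2)] base_left_proper[OF assms(3)] fiber_right base_right
    by (intro conjI impI ballI; elim conjE) simp_all
qed

end
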